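(* Let $\Phi$ be an $N$-function of class $\Delta_2(0)$. Let $N \le H \le G$ be a chain of countable discrete groups such that $N$ is an infinite normal subgroup of $G$ and $H$ is nonamenable. If $\overline{H}^1(H,\ell^\Phi(H))=0$, then $H^1(G,\ell^\Phi(G))=0$.
   Context: An $N$-function is a function $\Phi:\mathbb{R}\to\mathbb{R}$ of the form $\Phi(x)=\int_0^{|x|}\varphi(t)\,dt$, where $\varphi:[0,\infty)\to[0,\infty)$ is non-decreasing, right-continuous, $\varphi(0)=0$, $\varphi(t)>0$ for $t>0$, and $\lim_{t\to\infty}\varphi(t)=\infty$. $\Phi\in\Delta_2(0)$ means: there are $x_0>0$ and $K>2$ with $\Phi(2x)\le K\Phi(x)$ for $0\le x\le x_0$. For a countable set $X$ and $f:X\to\mathbb{R}$ put $\rho_\Phi(f)=\sum_{x\in X}\Phi(f(x))$. The Orlicz space is $\ell^\Phi(X)=\{f:X\to\mathbb{R} : \rho_\Phi(af)<\infty \text{ for some } a>0\}$, equipped with the gauge norm $\|f\|_{(\Phi)}=\inf\{k>0 : \rho_\Phi(f/k)\le 1\}$. For a discrete group $G$, $\ell^\Phi(G)$ is a Banach $G$-module under the left regular representation $(\lambda_G(g)f)(x)=f(g^{-1}x)$. For a discrete group $G$ and a Banach $G$-module $V$ (a Banach space with a linear isometric representation $\pi$ of $G$): $Z^1(G,V)=\{b:G\to V : b(gh)=b(g)+\pi(g)b(h)\ \forall g,h\in G\}$; $B^1(G,V)$ is the subspace of those $b$ for which there is $v\in V$ with $b(g)=\pi(g)v-v$ for all $g\in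 G$; $H^1(G,V)=Z^1(G,V)/B^1(G,V)$. Equip $Z^1(G,V)$ with the topology of uniform convergence on compact (i.e. finite) subsets of $G$, and let $\overline{B}^1(G,V)$ be the closure of $B^1(G,V)$; the reduced 1-cohomology is $\overline{H}^1(G,V)=Z^1(G,V)/\overline{B}^1(G,V)$. *)

theory Defs
  imports
    "HOL-Analysis.Analysis"
    "HOL-Algebra.Elementary_Groups"
    "HOL-Library.Function_Algebras"
begin

section \<open>Orlicz sequence spaces\<close>

text \<open>The density \<open>\<phi>\<close> lives on \<open>[0, \<infinity>)\<close>; its values on negative reals are irrelevant.
  That it takes nonnegative values follows from the monotonicity and \<open>\<phi> 0 = 0\<close>.\<close>

definition N_function :: "(real \<Rightarrow> real) \<Rightarrow> bool" where
  "N_function \<Phi> \<longleftrightarrow>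
    (\<exists>\<phi>. mono_on {0..} \<phi> \<and>
         (\<forall>t\<ge>0. continuous (at_right t) \<phi>) \<and>
         \<phi> 0 = 0 \<and> (\<forall>t>0. \<phi> t > 0) \<and>
         filterlim \<phi> at_top at_top \<and>
         (\<forall>x. \<Phi> x = integral {0..\<bar>x\<bar>} \<phi>))"

definition Delta2_at_0 :: "(real \<Rightarrow> real) \<Rightarrow> bool" where
  "Delta2_at_0 \<Phi> \<longleftrightarrow> (\<exists>x0>0. \<exists>K>2. \<forall>x. 0 \<le> x \<and> x \<le> x0 \<longrightarrow> \<Phi> (2 * x) \<le> K * \<Phi> x)"

definition modular :: "(real \<Rightarrow> real) \<Rightarrow> 'a set \<Rightarrow> ('a \<Rightarrow> real) \<Rightarrow> ennreal" where
  "modular \<Phi> X f = (\<Sum>\<^sub>\<infinity>x\<in>X. ennreal (\<Phi> (f x)))"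

text \<open>A function \<open>X \<rightarrow> \<real>\<close> is represented by its extension by zero to the whole type, so that
  sums and differences in the function space are the pointwise ones.\<close>

definition orlicz_space :: "(real \<Rightarrow> real) \<Rightarrow> 'a set \<Rightarrow> ('a \<Rightarrow> real) set" where
  "orlicz_space \<Phi> X =
    {f. (\<forall>x. x \<notin> X \<longrightarrow> f x = 0) \<and> (\<exists>a>0. modular \<Phi> X (\<lambda>x. a * f x) < \<infinity>)}"

definition gauge_norm :: "(real \<Rightarrow> real) \<Rightarrow> 'a set \<Rightarrow> ('a \<Rightarrow> real) \<Rightarrow> real" where
  "gauge_norm \<Phi> X f = Inf {k. k > 0 \<and> modular \<Phi> X (\<lambda>x. f x / k) \<le> 1}"

definition left_regular :: "('g, 'm) monoid_scheme \<Rightarrow> 'g \<Rightarrow> ('g \<Rightarrow> real) \<Rightarrow> ('g \<Rightarrow> real)" where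
  "left_regular G g f = (\<lambda>x. if x \<in> carrier G then f (inv\<^bsub>G\<^esub> g \<otimes>\<^bsub>G\<^esub> x) else 0)"


section \<open>First cohomology of a discrete group\<close>

text \<open>A Banach \<open>G\<close>-module is given by its underlying set \<open>V\<close> (an additive subgroup of the
  ambient type), its norm \<open>nrm\<close> and the representation \<open>\<pi>\<close>. Maps \<open>G \<rightarrow> V\<close> are again extended
  by zero outside the carrier of \<open>G\<close>.\<close>

definition cocycles ::
  "('g, 'm) monoid_scheme \<Rightarrow> 'v::ab_group_add set \<Rightarrow> ('g \<Rightarrow> 'v \<Rightarrow> 'v) \<Rightarrow> ('g \<Rightarrow> 'v) set" where
  "cocycles G V \<pi> =
    {b. (\<forall>g\<in>carrier G. b g \<in> V) \<and> (\<forall>g. g \<notin> carrier G \<longrightarrow> b g = 0) \<and>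
        (\<forall>g\<in>carrier G. \<forall>h\<in>carrier G. b (g \<otimes>\<^bsub>G\<^esub> h) = b g + \<pi> g (b h))}"

definition coboundaries ::
  "('g, 'm) monoid_scheme \<Rightarrow> 'v::ab_group_add set \<Rightarrow> ('g \<Rightarrow> 'v \<Rightarrow> 'v) \<Rightarrow> ('g \<Rightarrow> 'v) set" where
  "coboundaries G V \<pi> =
    {b \<in> cocycles G V \<pi>. \<exists>v\<in>V. \<forall>g\<in>carrier G. b g = \<pi> g v - v}"

text \<open>The topology of uniform convergence on finite subsets of \<open>G\<close>.\<close>

definition cocycle_topology ::
  "('g, 'm) monoid_scheme \<Rightarrow> 'v::ab_group_add set \<Rightarrow> ('v \<Rightarrow> real) \<Rightarrow> ('g \<Rightarrow> 'v \<Rightarrow> 'v)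
    \<Rightarrow> ('g \<Rightarrow> 'v) topology" where
  "cocycle_topology G V nrm \<pi> =
    topology (\<lambda>U. U \<subseteq> cocycles G V \<pi> \<and>
      (\<forall>b\<in>U. \<exists>F e. finite F \<and> F \<subseteq> carrier G \<and> e > 0 \<and>
        {c \<in> cocycles G V \<pi>. \<forall>g\<in>F. nrm (c g - b g) < e} \<subseteq> U))"

lemma openin_cocycle_topology:
  "openin (cocycle_topology G V nrm \<pi>) U \<longleftrightarrow>
    U \<subseteq> cocycles G V \<pi> \<and>
    (\<forall>b\<in>U. \<exists>F e. finite F \<and> F \<subseteq> carrier G \<and> e > 0 \<and>
      {c \<in> cocycles G V \<pi>. \<forall>g\<in>F. nrm (c g - b g) < e} \<subseteq> U)"
proof -
  let ?N = "\<lambda>b F e. {c \<in> cocycles G V \<pi>. \<forall>g\<in>F. nrm (c g - b g) < e}"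
  let ?P = "\<lambda>U. U \<subseteq> cocycles G V \<pi> \<and>
    (\<forall>b\<in>U. \<exists>F e. finite F \<and> F \<subseteq> carrier G \<and> e > 0 \<and> ?N b F e \<subseteq> U)"
  have "?P (S \<inter> T)" if "?P S" "?P T" for S T
  proof (intro conjI ballI)
    show "S \<inter> T \<subseteq> cocycles G V \<pi>" using that by blast
    fix b assume "b \<in> S \<inter> T"
    then have "b \<in> S" "b \<in> T" by auto
    from \<open>b \<in> S\<close> that(1) obtain F e where
      1: "finite F" "F \<subseteq> carrier G" "e > 0" "?N b F e \<subseteq> S" by meson
    from \<open>b \<in> T\<close> that(2) obtain F' e' where
      2: "finite F'" "F' \<subseteq> carrier G" "e' > 0" "?N b F' e' \<subseteq> T" by meson
    have "?N b (F \<union> F') (min e e') \<subseteq> S \<inter> T" using 1(4) 2(4) by auto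
    with 1 2 show "\<exists>F e. finite F \<and> F \<subseteq> carrier G \<and> e > 0 \<and> ?N b F e \<subseteq> S \<inter> T"
      by (intro exI[of _ "F \<union> F'"] exI[of _ "min e e'"]) simp
  qed
  moreover have "?P (\<Union>K)" if "\<forall>U\<in>K. ?P U" for K
  proof (intro conjI ballI)
    show "\<Union>K \<subseteq> cocycles G V \<pi>" using that by blast
    fix b assume "b \<in> \<Union>K"
    then obtain U where "U \<in> K" "b \<in> U" by blast
    moreover from this that obtain F e where
      "finite F" "F \<subseteq> carrier G" "e > 0" "?N b F e \<subseteq> U" by meson
    ultimately show "\<exists>F e. finite F \<and> F \<subseteq> carrier G \<and> e > 0 \<and> ?N b F e \<subseteq> \<Union>K"
      by (meson Union_upper subset_trans)
  qed
  ultimately have "istopology ?P"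
    unfolding istopology_def by blast
  then show ?thesis
    by (simp add: cocycle_topology_def topology_inverse')
qed

lemma topspace_cocycle_topology [simp]:
  "topspace (cocycle_topology G V nrm \<pi>) = cocycles G V \<pi>"
proof -
  have "openin (cocycle_topology G V nrm \<pi>) (cocycles G V \<pi>)"
    unfolding openin_cocycle_topology
    by (auto intro!: exI[of _ "{}"] exI[of _ "1::real"])
  then show ?thesis
    by (meson openin_cocycle_topology openin_subset openin_topspace subset_antisym)
qed

definition closed_coboundaries ::
  "('g, 'm) monoid_scheme \<Rightarrow> 'v::ab_group_add set \<Rightarrow> ('v \<Rightarrow> real) \<Rightarrow> ('g \<Rightarrow> 'v \<Rightarrow> 'v)
    \<Rightarrow> ('g \<Rightarrow> 'v) set" where
  "closed_coboundaries G V nrm \<pi> = cocycle_topology G V nrm \<pi> closure_of coboundaries G V \<pi>"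

text \<open>Only the additive group structure of the quotient spaces is recorded, which is all that
  their vanishing depends on.\<close>

definition cocycle_group ::
  "('g, 'm) monoid_scheme \<Rightarrow> 'v::ab_group_add set \<Rightarrow> ('g \<Rightarrow> 'v \<Rightarrow> 'v) \<Rightarrow> ('g \<Rightarrow> 'v) monoid" where
  "cocycle_group G V \<pi> = \<lparr>carrier = cocycles G V \<pi>, monoid.mult = (+), one = 0\<rparr>"

definition H1 ::
  "('g, 'm) monoid_scheme \<Rightarrow> 'v::ab_group_add set \<Rightarrow> ('g \<Rightarrow> 'v \<Rightarrow> 'v) \<Rightarrow> ('g \<Rightarrow> 'v) set monoid" where
  "H1 G V \<pi> = cocycle_group G V \<pi> Mod coboundaries G V \<pi>"

definition reduced_H1 ::
  "('g, 'm) monoid_scheme \<Rightarrow> 'v::ab_group_add set \<Rightarrow> ('v \<Rightarrow> real) \<Rightarrow> ('g \<Rightarrow> 'v \<Rightarrow> 'v)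
    \<Rightarrow> ('g \<Rightarrow> 'v) set monoid" where
  "reduced_H1 G V nrm \<pi> = cocycle_group G V \<pi> Mod closed_coboundaries G V nrm \<pi>"


section \<open>Amenability of a discrete group\<close>

text \<open>Existence of a left-invariant, finitely additive probability measure defined on all
  subsets of the group.\<close>

definition amenable :: "('g, 'm) monoid_scheme \<Rightarrow> bool" where
  "amenable G \<longleftrightarrow>
    (\<exists>\<mu> :: 'g set \<Rightarrow> real.
      (\<forall>A. A \<subseteq> carrier G \<longrightarrow> \<mu> A \<ge> 0) \<and>
      \<mu> (carrier G) = 1 \<and>
      (\<forall>A B. A \<subseteq> carrier G \<and> B \<subseteq> carrier G \<and> A \<inter> B = {} \<longrightarrow> \<mu> (A \<union> B) = \<mu> A + \<mu> B) \<and>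
      (\<forall>g\<in>carrier G. \<forall>A. A \<subseteq> carrier G \<longrightarrow> \<mu> (g <#\<^bsub>G\<^esub> A) = \<mu> A))"

end

theory Submission
  imports Defs
begin

text \<open>
  Let \<open>b\<close> be a 1-cocycle of \<open>G\<close> with values in \<open>\<ell>\<^sup>\<Phi>(G)\<close>. If the restriction of \<open>b\<close> to \<open>H\<close> is a
  coboundary \<open>h \<mapsto> \<lambda>(h) f - f\<close>, then after subtracting the coboundary of \<open>f\<close> the cocycle vanishes
  on \<open>N\<close>. Comparing \<open>b(n g)\<close> with \<open>b(g (g\<inverse> n g))\<close> shows that all its values are then invariant
  under \<open>N\<close>; a function that is constant on the infinite cosets of \<open>N\<close> and has a finite modular is
  zero, so \<open>b\<close> is a coboundary (\<open>cocycle_vanishing_on_infinite_normal_subgroup\<close>).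

  The restriction to \<open>H\<close> is a coboundary because nonamenability upgrades the vanishing of the
  reduced cohomology of \<open>H\<close> to that of the unreduced one, with estimates. If \<open>H\<close> is not amenable,
  then there is no sequence of almost invariant vectors in \<open>\<ell>\<^sup>1(H)\<close>. Applied to \<open>\<Psi> \<circ> f\<close>
  this yields a finite set \<open>S\<close> and a constant \<open>C\<close> with
  \<open>\<rho>(f) \<le> C \<Sum>\<^bsub>s \<in> S\<^esub> \<rho>(\<lambda>(s) f - f)\<close> for all \<open>f \<in> \<ell>\<^sup>\<Phi>(H)\<close> (\<open>nonamenable_imp_modular_gap\<close>).
  If a cocycle \<open>c\<close> of \<open>H\<close> is a limit of coboundaries of functions \<open>v\<^sub>n\<close>, then this
  inequality bounds \<open>\<rho>(v\<^sub>n)\<close>, so that a pointwise cluster point \<open>v\<close> exists and lies in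
  \<open>\<ell>\<^sup>\<Phi>(H)\<close>; \<open>c\<close> is the coboundary of \<open>v\<close>, and
  \<open>\<rho>(v) \<le> C \<Sum>\<^bsub>s \<in> S\<^esub> \<rho>(c(s))\<close> with the same constant for all cocycles
  (\<open>cocycle_is_bounded_coboundary\<close>). The restriction of \<open>b\<close> to \<open>H\<close> splits into one such cocycle for
  each right coset of \<open>H\<close> in \<open>G\<close>, and the uniform estimate is what makes the functions found on the
  possibly infinitely many cosets fit together to an element of \<open>\<ell>\<^sup>\<Phi>(G)\<close>
  (\<open>restriction_is_coboundary\<close>).

  All inequalities are between modulars instead of norms, since modulars add up over disjoint sets.
  For them to hold with uniform constants the doubling condition is needed on the whole line and not
  only near \<open>0\<close>. Therefore \<open>\<Phi>\<close> is replaced by a function \<open>\<Psi>\<close> that agrees with \<open>\<Phi>\<close> near \<open>0\<close>, grows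
  linearly at infinity and satisfies a global doubling condition
  (\<open>Delta2_imp_doubling_modification\<close>). As the values of a function in \<open>\<ell>\<^sup>\<Phi>\<close> are
  small outside a finite set, \<open>\<Psi>\<close> defines the same space, and small gauge norms force small
  \<open>\<Psi>\<close>-modulars.
\<close>

section \<open>Young functions and the doubling condition\<close>

locale young =
  fixes \<Psi> :: "real \<Rightarrow> real"
  assumes convex: "convex_on UNIV \<Psi>"
    and even: "\<Psi> (- x) = \<Psi> x"
    and zero [simp]: "\<Psi> 0 = 0"
    and pos: "x \<noteq> 0 \<Longrightarrow> 0 < \<Psi> x"
begin

lemma nonneg [simp]: "0 \<le> \<Psi> x"
  using pos[of x] by (cases "x = 0") auto

lemma abs_eq [simp]: "\<Psi> \<bar>x\<bar> = \<Psi> x"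
  using even[of x] by (simp add: abs_if)

lemma convex_comb:
  assumes "0 \<le> t" "t \<le> 1"
  shows "\<Psi> ((1 - t) * x + t * y) \<le> (1 - t) * \<Psi> x + t * \<Psi> y"
  using convex_onD[OF convex assms, of x y] by simp

lemma scale_le:
  assumes "0 \<le> t" "t \<le> 1"
  shows "\<Psi> (t * x) \<le> t * \<Psi> x"
  using convex_comb[OF assms, of 0 x] by simp

lemma mono:
  assumes "\<bar>x\<bar> \<le> \<bar>y\<bar>"
  shows "\<Psi> x \<le> \<Psi> y"
proof (cases "y = 0")
  case False
  define t where "t = \<bar>x\<bar> / \<bar>y\<bar>"
  have t: "0 \<le> t" "t \<le> 1" "\<bar>x\<bar> = t * \<bar>y\<bar>"
    using assms False by (auto simp: t_def)
  have "\<Psi> x \<le> t * \<Psi> y"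
    using scale_le[OF t(1,2), of "\<bar>y\<bar>"] by (simp flip: t(3))
  also have "\<dots> \<le> 1 * \<Psi> y"
    using t by (intro mult_right_mono) auto
  finally show ?thesis by simp
qed (use assms in auto)

lemma abs_le_of_le:
  assumes "\<Psi> x \<le> M"
  shows "\<bar>x\<bar> \<le> 1 + M / \<Psi> 1"
proof (cases "\<bar>x\<bar> \<le> 1")
  case True
  have "0 \<le> M"
    using assms nonneg[of x] by linarith
  then have "0 \<le> M / \<Psi> 1"
    by simp
  then show ?thesis
    using True by linarith
next
  case False
  have "\<Psi> (1 / \<bar>x\<bar> * \<bar>x\<bar>) \<le> 1 / \<bar>x\<bar> * \<Psi> \<bar>x\<bar>"
    using False by (intro scale_le) auto
  moreover have "1 / \<bar>x\<bar> * \<bar>x\<bar> = 1"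
    using False by auto
  ultimately have "\<Psi> 1 \<le> \<Psi> x / \<bar>x\<bar>"
    by simp
  also have "\<dots> \<le> M / \<bar>x\<bar>"
    using assms by (intro divide_right_mono) auto
  finally have "\<bar>x\<bar> * \<Psi> 1 \<le> M"
    using False by (auto simp: field_simps)
  then have "\<bar>x\<bar> \<le> M / \<Psi> 1"
    using pos[of 1] by (simp add: field_simps)
  then show ?thesis by simp
qed

lemma continuous: "continuous_on A \<Psi>"
  using convex_on_continuous[OF open_UNIV convex] continuous_on_subset by blast

end

locale doubling_young = young +
  fixes K :: real
  assumes doubling: "\<Psi> (2 * x) \<le> K * \<Psi> x"
begin

lemma K_nonneg: "0 \<le> K"
proof -
  have "0 < K * \<Psi> 1"
    using doubling[of 1] pos[of 2] by simp
  then show ?thesis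
    using pos[of 1] by (simp add: zero_less_mult_iff)
qed

lemma add_le: "\<Psi> (a + b) \<le> K * (\<Psi> a + \<Psi> b)"
proof -
  define m where "m = max \<bar>a\<bar> \<bar>b\<bar>"
  have "\<Psi> (a + b) \<le> \<Psi> (2 * m)"
    by (rule mono) (auto simp: m_def)
  also have "\<dots> \<le> K * \<Psi> m"
    by (rule doubling)
  also have "\<Psi> m \<le> \<Psi> a + \<Psi> b"
    unfolding m_def by (simp add: max_def)
  finally show ?thesis
    using K_nonneg by (simp add: mult_left_mono)
qed

lemma diff_le: "\<Psi> (a - b) \<le> K * (\<Psi> a + \<Psi> b)"
  using add_le[of a "-b"] by (simp add: even)

lemma power_scale_le: "\<Psi> (2 ^ n * x) \<le> K ^ n * \<Psi> x"
proof (induction n)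
  case (Suc n)
  have "\<Psi> (2 * (2 ^ n * x)) \<le> K * \<Psi> (2 ^ n * x)"
    by (rule doubling)
  also have "\<dots> \<le> K * (K ^ n * \<Psi> x)"
    using Suc K_nonneg by (rule mult_left_mono)
  finally show ?case by (simp add: ac_simps)
qed simp

lemma scale_bound: "\<exists>C\<ge>0. \<forall>x. \<Psi> (c * x) \<le> C * \<Psi> x"
proof -
  obtain n where n: "\<bar>c\<bar> < 2 ^ n"
    using real_arch_pow[of 2 "\<bar>c\<bar>"] by auto
  have "\<Psi> (c * x) \<le> K ^ n * \<Psi> x" for x
  proof -
    have "\<Psi> (c * x) \<le> \<Psi> (2 ^ n * x)"
      using n by (intro mono) (simp add: abs_mult mult_right_mono)
    then show ?thesis using power_scale_le[of n x] by simp
  qed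
  then show ?thesis
    using K_nonneg by (intro exI[of _ "K ^ n"]) auto
qed

text \<open>Write \<open>a\<close> as the convex combination \<open>(1 - t) b + t (b + (a - b) / t)\<close>. Convexity and the doubling
  condition give \<open>\<Psi> a - \<Psi> b \<le> t K (\<Psi> b + \<Psi> ((a - b) / t))\<close>; for small \<open>t\<close> the coefficient of
  \<open>\<Psi> b\<close> is small, and for \<open>t\<close> a power of \<open>1/2\<close> the last term is a multiple of \<open>\<Psi> (a - b)\<close>.
  This is what transfers estimates from \<open>\<ell>\<^sup>1\<close> to modulars.\<close>

lemma increment_bound:
  assumes "0 < \<delta>"
  shows "\<exists>C\<ge>0. \<forall>a b. \<bar>\<Psi> a - \<Psi> b\<bar> \<le> \<delta> * (\<Psi> a + \<Psi> b) + C * \<Psi> (a - b)"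
proof -
  obtain n where n: "(K + 1) / \<delta> < 2 ^ n"
    using real_arch_pow[of 2 "(K + 1) / \<delta>"] by auto
  define t where "t = 1 / (2::real) ^ n"
  have t: "0 < t" "t \<le> 1"
    by (auto simp: t_def)
  have tK: "t * K \<le> \<delta>"
    using n assms K_nonneg by (simp add: t_def field_simps)
  have half: "\<Psi> a - \<Psi> b \<le> \<delta> * \<Psi> b + t * K * K ^ n * \<Psi> (a - b)" for a b
  proof -
    define d where "d = 2 ^ n * (a - b)"
    have d: "t * d = a - b"
      by (simp add: d_def t_def)
    have "a = (1 - t) * b + t * (b + d)"
      using d by (simp add: algebra_simps)
    then have "\<Psi> a \<le> (1 - t) * \<Psi> b + t * \<Psi> (b + d)"
      using convex_comb[of t b "b + d"] t by simp
    also have "\<dots> \<le> (1 - t) * \<Psi> b + t * (K * (\<Psi> b + K ^ n * \<Psi> (a - b)))"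
    proof -
      have "\<Psi> (b + d) \<le> K * (\<Psi> b + \<Psi> d)"
        by (rule add_le)
      also have "\<dots> \<le> K * (\<Psi> b + K ^ n * \<Psi> (a - b))"
        using K_nonneg power_scale_le[of n "a - b"]
        by (intro mult_left_mono add_left_mono) (auto simp: d_def)
      finally show ?thesis
        using t by simp
    qed
    also have "\<dots> \<le> \<Psi> b + t * K * \<Psi> b + t * K * K ^ n * \<Psi> (a - b)"
      using t by (simp add: algebra_simps)
    also have "\<dots> \<le> \<Psi> b + \<delta> * \<Psi> b + t * K * K ^ n * \<Psi> (a - b)"
      using tK by (simp add: mult_right_mono)
    finally show ?thesis by simp
  qed
  have "\<bar>\<Psi> a - \<Psi> b\<bar> \<le> \<delta> * (\<Psi> a + \<Psi> b) + (t * K * K ^ n) * \<Psi> (a - b)" for a b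
  proof -
    have "\<Psi> (b - a) = \<Psi> (a - b)"
      using even[of "a - b"] by simp
    moreover have "0 \<le> \<delta> * \<Psi> a" "0 \<le> \<delta> * \<Psi> b"
      using assms by auto
    ultimately show ?thesis
      using half[of a b] half[of b a] by (simp add: abs_le_iff algebra_simps)
  qed
  then show ?thesis
    using t K_nonneg by (intro exI[of _ "t * K * K ^ n"]) auto
qed

end

text \<open>The density \<open>\<psi>\<close> is a subgradient of its primitive, because it is monotone. Convexity, positivity
  and growth of Young functions given by a density all follow from this inequality.\<close>

lemma primitive_subgradient:
  fixes \<psi> :: "real \<Rightarrow> real"
  assumes mono: "mono_on {0..} \<psi>" and "\<psi> 0 = 0"
    and x: "0 \<le> x"
  shows "integral {0..\<bar>x\<bar>} \<psi> + \<psi> x * (y - x) \<le> integral {0..\<bar>y\<bar>} \<psi>"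
proof -
  have int: "\<psi> integrable_on {a..b}" if "0 \<le> a" for a b
    using that by (intro integrable_on_mono_on mono_on_subset[OF mono]) auto
  have nonneg: "0 \<le> \<psi> t" if "0 \<le> t" for t
    using mono_onD[OF mono, of 0 t] that assms(2) by simp
  have "integral {0..x} \<psi> + \<psi> x * (z - x) \<le> integral {0..z} \<psi>" if z: "0 \<le> z" for z
  proof (cases "x \<le> z")
    case True
    have "integral {x..z} (\<lambda>_. \<psi> x) \<le> integral {x..z} \<psi>"
      using x by (intro integral_le int) (auto intro!: mono_onD[OF mono])
    moreover have "integral {0..x} \<psi> + integral {x..z} \<psi> = integral {0..z} \<psi>"
      using x True by (intro Henstock_Kurzweil_Integration.integral_combine int) auto
    ultimately show ?thesis
      using True by (simp add: mult.commute)
  next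
    case False
    have "integral {z..x} \<psi> \<le> integral {z..x} (\<lambda>_. \<psi> x)"
      using z by (intro integral_le int) (auto intro!: mono_onD[OF mono])
    moreover have "integral {0..z} \<psi> + integral {z..x} \<psi> = integral {0..x} \<psi>"
      using z False by (intro Henstock_Kurzweil_Integration.integral_combine int) auto
    ultimately show ?thesis
      using False by (simp add: algebra_simps)
  qed
  from this[of "\<bar>y\<bar>"] have "integral {0..x} \<psi> + \<psi> x * (\<bar>y\<bar> - x) \<le> integral {0..\<bar>y\<bar>} \<psi>"
    by simp
  moreover have "\<psi> x * (y - x) \<le> \<psi> x * (\<bar>y\<bar> - x)"
    using nonneg[OF x] by (intro mult_left_mono) auto
  ultimately show ?thesis
    using x by simp
qed

lemma young_primitive:
  fixes \<psi> :: "real \<Rightarrow> real"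
  assumes mono: "mono_on {0..} \<psi>" and zero: "\<psi> 0 = 0" and pos: "\<And>t. 0 < t \<Longrightarrow> 0 < \<psi> t"
  shows "young (\<lambda>x. integral {0..\<bar>x\<bar>} \<psi>)"
proof
  let ?F = "\<lambda>x. integral {0..\<bar>x\<bar>} \<psi>"
  note sub = primitive_subgradient[OF mono zero]
  show "convex_on UNIV ?F"
  proof
    fix t x y :: real
    assume t: "0 < t" "t < 1"
    define z where "z = (1 - t) * x + t * y"
    \<comment> \<open>It suffices to find a supporting line at every point; for negative points it is obtained by reflection.\<close>
    have "\<exists>m. \<forall>w. ?F z + m * (w - z) \<le> ?F w"
    proof (cases "0 \<le> z")
      case True
      then show ?thesis using sub[of z] by blast
    next
      case False
      then have "?F z + (- \<psi> (- z)) * (w - z) \<le> ?F w" for w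
        using sub[of "- z" "- w"] by (simp add: algebra_simps)
      then show ?thesis by blast
    qed
    then obtain m where m: "\<And>w. ?F z + m * (w - z) \<le> ?F w"
      by blast
    have "(1 - t) * (?F z + m * (x - z)) + t * (?F z + m * (y - z)) \<le> (1 - t) * ?F x + t * ?F y"
      using t m by (intro add_mono mult_left_mono) auto
    moreover have "(1 - t) * (?F z + m * (x - z)) + t * (?F z + m * (y - z)) = ?F z"
      unfolding z_def by (simp add: algebra_simps)
    ultimately show "?F ((1 - t) *\<^sub>R x + t *\<^sub>R y) \<le> (1 - t) * ?F x + t * ?F y"
      by (simp add: z_def)
  qed simp
  show "0 < ?F x" if "x \<noteq> 0" for x
  proof -
    have "integral {0..0} \<psi> + 0 \<le> ?F (\<bar>x\<bar> / 2)"
      using sub[of 0 "\<bar>x\<bar> / 2"] zero by simp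
    moreover have "?F (\<bar>x\<bar> / 2) + \<psi> (\<bar>x\<bar> / 2) * (\<bar>x\<bar> - \<bar>x\<bar> / 2) \<le> ?F x"
      using sub[of "\<bar>x\<bar> / 2" "\<bar>x\<bar>"] by simp
    moreover have "0 < \<psi> (\<bar>x\<bar> / 2) * (\<bar>x\<bar> - \<bar>x\<bar> / 2)"
      using that by (intro mult_pos_pos pos) auto
    ultimately show ?thesis by simp
  qed
qed auto

lemma N_function_imp_young:
  assumes "N_function \<Phi>"
  shows "young \<Phi>"
proof -
  obtain \<phi> where "mono_on {0..} \<phi>" "\<phi> 0 = 0" "\<forall>t>0. 0 < \<phi> t"
    and \<Phi>: "\<forall>x. \<Phi> x = integral {0..\<bar>x\<bar>} \<phi>"
    using assms unfolding N_function_def by blast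
  then have "young (\<lambda>x. integral {0..\<bar>x\<bar>} \<phi>)"
    by (intro young_primitive) auto
  also have "(\<lambda>x. integral {0..\<bar>x\<bar>} \<phi>) = \<Phi>"
    using \<Phi> by auto
  finally show ?thesis .
qed

text \<open>Cutting off the density at \<open>r\<close> makes the primitive linear beyond \<open>r\<close>. Below \<open>r / 2\<close> it inherits
  the doubling condition of \<open>\<Phi>\<close> near \<open>0\<close>; above, the increment \<open>\<Psi> (2 x) - \<Psi> x\<close> is at most linear
  in \<open>x\<close>, while \<open>\<Psi> x\<close> is at least linear by convexity.\<close>

lemma Delta2_imp_doubling_modification:
  assumes "N_function \<Phi>" "Delta2_at_0 \<Phi>"
  obtains \<Psi> K r where "doubling_young \<Psi> K" "0 < r" "\<And>x. \<bar>x\<bar> \<le> r \<Longrightarrow> \<Psi> x = \<Phi> x"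
proof -
  obtain \<phi> where mono: "mono_on {0..} \<phi>" and \<phi>0: "\<phi> 0 = 0" and \<phi>_pos: "\<And>t. 0 < t \<Longrightarrow> 0 < \<phi> t"
    and \<Phi>: "\<And>x. \<Phi> x = integral {0..\<bar>x\<bar>} \<phi>"
    using assms unfolding N_function_def by blast
  obtain r K where r: "0 < r" and K: "\<And>x. 0 \<le> x \<Longrightarrow> x \<le> r \<Longrightarrow> \<Phi> (2 * x) \<le> K * \<Phi> x"
    using assms unfolding Delta2_at_0_def by blast
  define \<psi> where "\<psi> = (\<lambda>t. \<phi> (min t r))"
  define \<Psi> where "\<Psi> = (\<lambda>x. integral {0..\<bar>x\<bar>} \<psi>)"
  have mono': "mono_on {0..} \<psi>"
    using r by (auto simp: \<psi>_def intro!: mono_onI mono_onD[OF mono])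
  have \<psi>0: "\<psi> 0 = 0"
    using r \<phi>0 by (simp add: \<psi>_def)
  interpret young \<Psi>
    unfolding \<Psi>_def by (rule young_primitive[OF mono' \<psi>0]) (use r \<phi>_pos in \<open>auto simp: \<psi>_def\<close>)
  have agree: "\<Psi> x = \<Phi> x" if "\<bar>x\<bar> \<le> r" for x
    unfolding \<Psi>_def \<Phi> by (rule integral_cong) (use that in \<open>auto simp: \<psi>_def min_def\<close>)
  define L where "L = max K (1 + \<phi> r * r / (2 * \<Psi> (r / 2)))"
  have "\<Psi> (2 * x) \<le> L * \<Psi> x" if x: "0 \<le> x" for x
  proof (cases "2 * x \<le> r")
    case True
    then have "\<Psi> (2 * x) \<le> K * \<Psi> x"
      using x K[of x] agree[of x] agree[of "2 * x"] by simp
    also have "\<dots> \<le> L * \<Psi> x"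
      by (intro mult_right_mono) (auto simp: L_def)
    finally show ?thesis .
  next
    case False
    have p: "0 < \<Psi> (r / 2)"
      using r by (intro pos) simp
    have "\<Psi> (2 * x) + \<psi> (2 * x) * (x - 2 * x) \<le> \<Psi> x"
      using primitive_subgradient[OF mono' \<psi>0, of "2 * x" x] x by (simp add: \<Psi>_def)
    moreover have "\<psi> (2 * x) = \<phi> r"
      using False by (simp add: \<psi>_def min_def)
    ultimately have 1: "\<Psi> (2 * x) \<le> \<Psi> x + x * \<phi> r"
      by (simp add: algebra_simps)
    have "\<Psi> (r / (2 * x) * x) \<le> r / (2 * x) * \<Psi> x"
      using False r by (intro scale_le) auto
    then have "x * \<Psi> (r / 2) \<le> r / 2 * \<Psi> x"
      using False r by (simp add: field_simps)
    then have "x \<le> r / 2 * \<Psi> x / \<Psi> (r / 2)"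
      using p by (simp add: pos_le_divide_eq)
    then have "x * \<phi> r \<le> r / 2 * \<Psi> x / \<Psi> (r / 2) * \<phi> r"
      using \<phi>_pos[OF r] by (intro mult_right_mono) auto
    then have "\<Psi> (2 * x) \<le> (1 + \<phi> r * r / (2 * \<Psi> (r / 2))) * \<Psi> x"
      using 1 by (simp add: algebra_simps)
    also have "\<dots> \<le> L * \<Psi> x"
      by (intro mult_right_mono) (auto simp: L_def)
    finally show ?thesis .
  qed
  from this[of "\<bar>x\<bar>" for x] have "\<Psi> (2 * x) \<le> L * \<Psi> x" for x
    using abs_eq[of "2 * x"] abs_eq[of x] by (metis abs_ge_zero abs_mult abs_numeral)
  then have "doubling_young \<Psi> L"
    by unfold_locales
  then show ?thesis
    using that r agree by blast
qed

section \<open>Nonamenability and almost invariant vectors\<close>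

text \<open>Tychonoff's theorem in the form of a limit along an ultrafilter: \<open>g\<close> inherits every pointwise
  closed condition that the \<open>f n\<close> satisfy eventually.\<close>

lemma pointwise_cluster_point:
  fixes f :: "nat \<Rightarrow> 'a \<Rightarrow> real"
  assumes "\<And>n x. \<bar>f n x\<bar> \<le> M x"
  obtains g where "\<And>P. closed {h. P h} \<Longrightarrow> eventually (\<lambda>n. P (f n)) sequentially \<Longrightarrow> P g"
proof -
  let ?S = "PiE UNIV (\<lambda>x. {- M x..M x})"
  let ?F = "filtermap f sequentially"
  have "compactin (product_topology (\<lambda>_. euclidean) UNIV) ?S"
    by (subst compactin_PiE) auto
  then have "compact ?S"
    by (simp add: euclidean_product_topology)
  moreover have "f n \<in> ?S" for n
    using assms[of n] by (auto simp: abs_le_iff) (metis minus_le_iff)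
  then have "eventually (\<lambda>h. h \<in> ?S) ?F"
    by (simp add: eventually_filtermap)
  moreover have "?F \<noteq> bot"
    by (simp add: filtermap_bot_iff)
  ultimately obtain g where g: "inf (nhds g) ?F \<noteq> bot"
    unfolding compact_filter by blast
  have "P g" if P: "closed {h. P h}" "eventually (\<lambda>n. P (f n)) sequentially" for P
  proof (rule ccontr)
    assume "\<not> P g"
    then have "eventually (\<lambda>h. h \<in> - {h. P h}) (nhds g)"
      using P(1) by (intro eventually_nhds_in_open) auto
    moreover have "eventually P ?F"
      using P(2) by (simp add: eventually_filtermap)
    ultimately have "eventually (\<lambda>h. False) (inf (nhds g) ?F)"
      unfolding eventually_inf by fastforce
    then show False
      using g by (simp add: eventually_False)
  qed
  then show ?thesis using that by blast
qed

lemma bij_betw_left_translation: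
  assumes "group K" "g \<in> carrier K"
  shows "bij_betw (\<lambda>x. g \<otimes>\<^bsub>K\<^esub> x) (carrier K) (carrier K)"
proof -
  interpret group K by fact
  show ?thesis
    by (rule bij_betw_byWitness[of _ "\<lambda>x. inv\<^bsub>K\<^esub> g \<otimes>\<^bsub>K\<^esub> x"])
       (use assms(2) in \<open>auto simp flip: m_assoc\<close>)
qed

text \<open>This is the Reiter condition. If there were almost invariant \<open>u n\<close>, then normalising them would
  give probability measures on \<open>K\<close> that are asymptotically invariant, and any cluster point of these
  measures, as functions of the set that is measured, would be an invariant mean.\<close>

lemma nonamenable_imp_no_almost_invariant_vectors:
  assumes K: "group K" and cnt: "countable (carrier K)" and "\<not> amenable K"
  obtains S \<epsilon> where "finite S" "S \<subseteq> carrier K" "0 < \<epsilon>"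
    "\<And>u :: 'a \<Rightarrow> real. (\<And>x. 0 \<le> u x) \<Longrightarrow> u summable_on carrier K \<Longrightarrow>
      \<epsilon> * infsum u (carrier K)
        \<le> (\<Sum>s\<in>S. \<Sum>\<^sub>\<infinity>x\<in>carrier K. \<bar>u (inv\<^bsub>K\<^esub> s \<otimes>\<^bsub>K\<^esub> x) - u x\<bar>)"
proof (rule ccontr)
  assume contr: "\<not> thesis"
  interpret group K by fact
  let ?X = "carrier K"
  define e where "e = from_nat_into ?X"
  have e: "range e = ?X"
    unfolding e_def using cnt one_closed by (intro range_from_nat_into) auto
  define D where "D = (\<lambda>u s. \<Sum>\<^sub>\<infinity>x\<in>?X. \<bar>u (inv\<^bsub>K\<^esub> s \<otimes>\<^bsub>K\<^esub> x) - u x\<bar> :: real)"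
  have "\<exists>u. (\<forall>x. 0 \<le> u x) \<and> u summable_on ?X \<and>
      (\<Sum>s\<in>e ` {..n}. D u s) < 1 / real (Suc n) * infsum u ?X" for n
  proof (rule ccontr)
    assume none: "\<not> ?thesis"
    have "1 / real (Suc n) * infsum u ?X \<le> (\<Sum>s\<in>e ` {..n}. D u s)"
      if "\<And>x. 0 \<le> u x" "u summable_on ?X" for u
      using none that by (meson not_le)
    then have thesis
      unfolding D_def using e by (intro that[of "e ` {..n}" "1 / real (Suc n)"]) auto
    with contr show False by blast
  qed
  then obtain u where u0: "\<And>n x. 0 \<le> u n x" and us: "\<And>n. u n summable_on ?X"
    and uD: "\<And>n. (\<Sum>s\<in>e ` {..n}. D (u n) s) < 1 / real (Suc n) * infsum (u n) ?X"
    by metis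
  define T where "T = (\<lambda>n. infsum (u n) ?X)"
  have D0: "0 \<le> D v s" for v s
    unfolding D_def by (intro infsum_nonneg) auto
  have T: "0 < T n" for n
  proof -
    have "0 \<le> (\<Sum>s\<in>e ` {..n}. D (u n) s)"
      by (intro sum_nonneg D0)
    then have "0 < 1 / real (Suc n) * T n"
      using uD[of n] unfolding T_def by linarith
    then show ?thesis
      by (simp add: zero_less_mult_iff zero_less_divide_iff)
  qed
  define m where "m = (\<lambda>n A. infsum (u n) (A \<inter> ?X) / T n)"
  have uA: "u n summable_on (A \<inter> ?X)" for n A
    using us by (rule summable_on_subset_banach) auto
  have m0: "0 \<le> m n A" for n A
    unfolding m_def using T[of n] by (intro divide_nonneg_pos infsum_nonneg u0)
  have "infsum (u n) (A \<inter> ?X) \<le> T n" for n A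
    unfolding T_def by (rule infsum_mono2[OF uA us]) (auto simp: u0)
  then have "m n A \<le> 1" for n A
    using T[of n] by (simp add: m_def)
  then have "\<bar>m n A\<bar> \<le> 1" for n A
    using m0[of n A] by simp
  then obtain \<mu> where
    \<mu>: "\<And>P. closed {h. P h} \<Longrightarrow> eventually (\<lambda>n. P (m n)) sequentially \<Longrightarrow> P \<mu>"
    using pointwise_cluster_point[of m "\<lambda>_. 1"] by blast
  note cont = continuous_on_product_coordinates continuous_intros
  have "0 \<le> \<mu> A" for A
    by (rule \<mu>) (use m0 in \<open>auto intro!: closed_Collect_le cont\<close>)
  moreover have "\<mu> ?X = 1"
  proof (rule \<mu>)
    have "m n ?X = 1" for n
      using T[of n] by (simp add: m_def T_def)
    then show "eventually (\<lambda>n. m n ?X = 1) sequentially" by simp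
  qed (intro closed_Collect_eq cont)
  moreover have "\<mu> (A \<union> B) = \<mu> A + \<mu> B" if AB: "A \<inter> B = {}" for A B
  proof (rule \<mu>)
    have "m n (A \<union> B) = m n A + m n B" for n
    proof -
      have "infsum (u n) ((A \<inter> ?X) \<union> (B \<inter> ?X)) = infsum (u n) (A \<inter> ?X) + infsum (u n) (B \<inter> ?X)"
        by (rule infsum_Un_disjoint[OF uA uA]) (use AB in auto)
      then show ?thesis
        by (simp add: m_def Int_Un_distrib2 add_divide_distrib)
    qed
    then show "eventually (\<lambda>n. m n (A \<union> B) = m n A + m n B) sequentially" by simp
  qed (intro closed_Collect_eq cont)
  moreover have "\<mu> (g <#\<^bsub>K\<^esub> A) = \<mu> A" if g: "g \<in> ?X" and A: "A \<subseteq> ?X" for g A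
  proof -
    \<comment> \<open>Moving the set by \<open>g\<close> amounts to translating the density by the inverse of \<open>g\<close>.\<close>
    obtain k where k: "e k = inv\<^bsub>K\<^esub> g"
      using e g by (metis inv_closed rangeE)
    have bound: "\<bar>m n (g <#\<^bsub>K\<^esub> A) - m n A\<bar> \<le> 1 / real (Suc n)" if n: "k \<le> n" for n
    proof -
      have inj: "inj_on (\<lambda>x. g \<otimes>\<^bsub>K\<^esub> x) A"
        using A g by (intro inj_onI) (auto simp: subset_iff)
      have eq: "(g <#\<^bsub>K\<^esub> A) \<inter> ?X = (\<lambda>x. g \<otimes>\<^bsub>K\<^esub> x) ` A" "A \<inter> ?X = A"
        using A g by (auto simp: l_coset_def)
      have sA: "u n summable_on A" "(\<lambda>x. u n (g \<otimes>\<^bsub>K\<^esub> x)) summable_on A"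
      proof -
        show "u n summable_on A"
          using uA[of n A] eq by simp
        have "(u n \<circ> (\<lambda>x. g \<otimes>\<^bsub>K\<^esub> x)) summable_on A"
          using uA[of n "g <#\<^bsub>K\<^esub> A"] summable_on_reindex[OF inj, of "u n"] by (simp add: eq(1))
        then show "(\<lambda>x. u n (g \<otimes>\<^bsub>K\<^esub> x)) summable_on A"
          by (simp add: o_def)
      qed
      have sX: "(\<lambda>x. u n (g \<otimes>\<^bsub>K\<^esub> x)) summable_on ?X"
        using summable_on_reindex_bij_betw[OF bij_betw_left_translation[OF K g]] us by blast
      have abs: "(\<lambda>x. \<bar>u n (g \<otimes>\<^bsub>K\<^esub> x) - u n x\<bar>) summable_on ?X"
      proof (rule summable_on_comparison_test[OF summable_on_add[OF sX us[of n]]])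
        show "\<bar>u n (g \<otimes>\<^bsub>K\<^esub> x) - u n x\<bar> \<le> u n (g \<otimes>\<^bsub>K\<^esub> x) + u n x" for x
          using u0[of n x] u0[of n "g \<otimes>\<^bsub>K\<^esub> x"] by linarith
      qed simp
      have "infsum (u n) ((g <#\<^bsub>K\<^esub> A) \<inter> ?X) - infsum (u n) (A \<inter> ?X)
          = (\<Sum>\<^sub>\<infinity>x\<in>A. u n (g \<otimes>\<^bsub>K\<^esub> x) - u n x)"
      proof -
        have "(\<Sum>\<^sub>\<infinity>x\<in>A. u n (g \<otimes>\<^bsub>K\<^esub> x) + - u n x)
            = (\<Sum>\<^sub>\<infinity>x\<in>A. u n (g \<otimes>\<^bsub>K\<^esub> x)) + (\<Sum>\<^sub>\<infinity>x\<in>A. - u n x)"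
          using sA by (intro infsum_add) (auto simp: summable_on_uminus)
        then show ?thesis
          by (simp add: eq infsum_reindex[OF inj] o_def infsum_uminus)
      qed
      also have "\<bar>\<dots>\<bar> \<le> (\<Sum>\<^sub>\<infinity>x\<in>A. \<bar>u n (g \<otimes>\<^bsub>K\<^esub> x) - u n x\<bar>)"
        using norm_infsum_bound[of "\<lambda>x. u n (g \<otimes>\<^bsub>K\<^esub> x) - u n x" A]
          summable_on_subset_banach[OF abs A] by simp
      also have "\<dots> \<le> D (u n) (inv\<^bsub>K\<^esub> g)"
        unfolding D_def using g A
        by (simp, intro infsum_mono2 abs summable_on_subset_banach[OF abs A]) auto
      also have "\<dots> \<le> (\<Sum>s\<in>e ` {..n}. D (u n) s)"
        using n k by (intro member_le_sum) (auto simp: D0 simp flip: k)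
      also have "\<dots> \<le> 1 / real (Suc n) * T n"
        using uD[of n] by (simp add: T_def)
      finally show ?thesis
        using T[of n] by (simp add: m_def field_simps flip: diff_divide_distrib)
    qed
    have "\<bar>\<mu> (g <#\<^bsub>K\<^esub> A) - \<mu> A\<bar> \<le> \<epsilon>" if "0 < \<epsilon>" for \<epsilon>
    proof (rule \<mu>)
      obtain j where j: "1 / real (Suc j) < \<epsilon>"
        using \<open>0 < \<epsilon>\<close> nat_approx_posE by blast
      have "\<bar>m n (g <#\<^bsub>K\<^esub> A) - m n A\<bar> \<le> \<epsilon>" if "max j k \<le> n" for n
      proof -
        have "1 / real (Suc n) \<le> 1 / real (Suc j)"
          using that by (intro divide_left_mono) auto
        then show ?thesis
          using bound[of n] j that by simp
      qed
      then show "eventually (\<lambda>n. \<bar>m n (g <#\<^bsub>K\<^esub> A) - m n A\<bar> \<le> \<epsilon>) sequentially"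
        unfolding eventually_sequentially by blast
    qed (intro closed_Collect_le cont)
    then have "\<bar>\<mu> (g <#\<^bsub>K\<^esub> A) - \<mu> A\<bar> \<le> 0"
      by (rule field_le_epsilon) simp
    then show ?thesis by simp
  qed
  ultimately have "amenable K"
    unfolding amenable_def by blast
  with \<open>\<not> amenable K\<close> show False by blast
qed

section \<open>Modulars and Orlicz spaces\<close>

lemma finite_superlevel_of_summable:
  fixes u :: "'a \<Rightarrow> real"
  assumes "u summable_on X" and nonneg: "\<And>x. x \<in> X \<Longrightarrow> 0 \<le> u x" and c: "0 < c"
  shows "finite {x \<in> X. c \<le> u x}"
proof (rule ccontr)
  assume inf: "infinite {x \<in> X. c \<le> u x}"
  obtain n :: nat where n: "infsum u X / c < real n"
    using reals_Archimedean2 by blast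
  obtain F where F: "finite F" "card F = n" "F \<subseteq> {x \<in> X. c \<le> u x}"
    using infinite_arbitrarily_large[OF inf, of n] by blast
  have "real n * c \<le> sum u F"
    using F sum_mono[of F "\<lambda>_. c" u] by auto
  also have "\<dots> \<le> infsum u X"
    using F nonneg by (intro finite_sum_le_infsum assms(1)) auto
  finally show False
    using n c by (simp add: field_simps)
qed

lemma nonneg_summable_bounded_by:
  fixes u :: "'a \<Rightarrow> real"
  assumes "\<And>x. x \<in> X \<Longrightarrow> 0 \<le> u x" and "\<And>F. finite F \<Longrightarrow> F \<subseteq> X \<Longrightarrow> sum u F \<le> M"
  shows "u summable_on X" and "infsum u X \<le> M"
proof -
  show "u summable_on X"
    using assms by (intro nonneg_bdd_above_summable_on bdd_aboveI[of _ M]) auto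
  then show "infsum u X \<le> M"
    using assms(2) by (rule infsum_le_finite_sums)
qed

lemma modular_le_iff:
  assumes "\<And>x. 0 \<le> \<Phi> x" "0 \<le> M"
  shows "modular \<Phi> X f \<le> ennreal M \<longleftrightarrow>
    (\<forall>F. finite F \<and> F \<subseteq> X \<longrightarrow> (\<Sum>x\<in>F. \<Phi> (f x)) \<le> M)"
  using assms by (simp add: modular_def nonneg_infsum_complete SUP_le_iff)

lemma modular_finite_iff:
  assumes "\<And>x. 0 \<le> \<Phi> x"
  shows "modular \<Phi> X f < \<infinity> \<longleftrightarrow> (\<lambda>x. \<Phi> (f x)) summable_on X"
proof
  assume fin: "modular \<Phi> X f < \<infinity>"
  then have "modular \<Phi> X f \<le> ennreal (enn2real (modular \<Phi> X f))"
    by simp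
  then show "(\<lambda>x. \<Phi> (f x)) summable_on X"
    using assms by (subst (asm) modular_le_iff) (auto intro: nonneg_summable_bounded_by(1))
next
  assume s: "(\<lambda>x. \<Phi> (f x)) summable_on X"
  have "modular \<Phi> X f \<le> ennreal (\<Sum>\<^sub>\<infinity>x\<in>X. \<Phi> (f x))"
    using assms s by (subst modular_le_iff) (auto intro!: infsum_nonneg finite_sum_le_infsum)
  then show "modular \<Phi> X f < \<infinity>"
    using le_less_trans by fastforce
qed

text \<open>A function with summable \<open>\<Phi>\<close>-values exceeds \<open>r\<close> only finitely often, and finitely many terms
  have no influence on summability.\<close>

lemma summable_of_agree_near_0:
  assumes "young \<Phi>" and agree: "\<And>x. \<bar>x\<bar> \<le> r \<Longrightarrow> \<Psi> x = \<Phi> x" and "0 < r"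
    and s: "(\<lambda>x. \<Phi> (f x)) summable_on X"
  shows "(\<lambda>x. \<Psi> (f x) :: real) summable_on X"
proof -
  interpret young \<Phi> by fact
  define B where "B = {x \<in> X. \<Phi> r \<le> \<Phi> (f x)}"
  have "finite B"
    unfolding B_def using s \<open>0 < r\<close> by (intro finite_superlevel_of_summable pos) auto
  moreover have "(\<lambda>x. \<Psi> (f x)) summable_on (X - B)"
  proof -
    have "\<Psi> (f x) = \<Phi> (f x)" if "x \<in> X - B" for x
    proof (rule agree, rule ccontr)
      assume "\<not> \<bar>f x\<bar> \<le> r"
      then have "\<Phi> r \<le> \<Phi> (f x)"
        using \<open>0 < r\<close> by (intro mono) auto
      then show False
        using that by (auto simp: B_def)
    qed
    then show ?thesis
      using summable_on_subset_banach[OF s, of "X - B"] summable_on_cong[of "X - B"] by (metis Diff_subset)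
  qed
  moreover have "X = B \<union> (X - B)"
    by (auto simp: B_def)
  ultimately show ?thesis
    by (metis Diff_disjoint summable_on_Un_disjoint summable_on_finite)
qed

text \<open>This is the triangle inequality for the gauge norm, stated for the scaling factors themselves.\<close>

lemma (in young) modular_add_le_1:
  assumes "modular \<Psi> X (\<lambda>x. f x / k) \<le> 1" "modular \<Psi> X (\<lambda>x. g x / l) \<le> 1" "0 < k" "0 < l"
  shows "modular \<Psi> X (\<lambda>x. (f x + g x) / (k + l)) \<le> 1"
proof -
  note iff = modular_le_iff[of \<Psi> 1, simplified]
  have "(\<Sum>x\<in>F. \<Psi> ((f x + g x) / (k + l))) \<le> 1" if F: "finite F" "F \<subseteq> X" for F
  proof -
    define t where "t = l / (k + l)"
    have t: "0 \<le> t" "t \<le> 1" "1 - t = k / (k + l)"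
      using assms(3,4) by (auto simp: t_def field_simps)
    have "\<Psi> ((f x + g x) / (k + l)) \<le> (1 - t) * \<Psi> (f x / k) + t * \<Psi> (g x / l)" for x
    proof -
      have "(f x + g x) / (k + l) = (1 - t) * (f x / k) + t * (g x / l)"
        unfolding t(3) using assms(3,4) by (simp add: t_def add_divide_distrib)
      then show ?thesis
        using convex_comb[OF t(1,2), of "f x / k" "g x / l"] by simp
    qed
    then have "(\<Sum>x\<in>F. \<Psi> ((f x + g x) / (k + l)))
        \<le> (1 - t) * (\<Sum>x\<in>F. \<Psi> (f x / k)) + t * (\<Sum>x\<in>F. \<Psi> (g x / l))"
      unfolding sum_distrib_left sum.distrib[symmetric] by (rule sum_mono)
    also have "\<dots> \<le> (1 - t) * 1 + t * 1"
      using assms(1,2) F t unfolding iff by (intro add_mono mult_left_mono) auto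
    finally show ?thesis by simp
  qed
  then show ?thesis
    unfolding iff by blast
qed

text \<open>The gauge norm is an infimum of reals, so it carries information only if some scaling factor is
  admissible; convexity provides one for every element of the Orlicz space.\<close>

lemma (in young) gauge_norm_less_imp_modular_le_1:
  assumes "f \<in> orlicz_space \<Psi> X" "gauge_norm \<Psi> X f < e"
  obtains k where "0 < k" "k < e" "modular \<Psi> X (\<lambda>x. f x / k) \<le> 1"
proof -
  note iff = modular_le_iff[of \<Psi> 1, simplified]
  obtain a where a: "0 < a" "modular \<Psi> X (\<lambda>x. a * f x) < \<infinity>"
    using assms(1) unfolding orlicz_space_def by blast
  have s: "(\<lambda>x. \<Psi> (a * f x)) summable_on X"
    using a(2) modular_finite_iff[of \<Psi> X "\<lambda>x. a * f x"] by simp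
  define M where "M = max 1 (\<Sum>\<^sub>\<infinity>x\<in>X. \<Psi> (a * f x))"
  have M: "1 \<le> M" "(\<Sum>\<^sub>\<infinity>x\<in>X. \<Psi> (a * f x)) \<le> M"
    by (auto simp: M_def)
  have "(\<Sum>x\<in>F. \<Psi> (f x / (M / a))) \<le> 1" if F: "finite F" "F \<subseteq> X" for F
  proof -
    have "(\<Sum>x\<in>F. \<Psi> (f x / (M / a))) \<le> (\<Sum>x\<in>F. 1 / M * \<Psi> (a * f x))"
      using scale_le[of "1 / M"] M(1) by (intro sum_mono) (simp add: field_simps)
    also have "\<dots> = 1 / M * (\<Sum>x\<in>F. \<Psi> (a * f x))"
      by (simp add: sum_distrib_left)
    also have "\<dots> \<le> 1 / M * M"
      using F M by (intro mult_left_mono order_trans[OF finite_sum_le_infsum[OF s]]) auto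
    finally show ?thesis using M(1) by simp
  qed
  then have "M / a \<in> {k. k > 0 \<and> modular \<Psi> X (\<lambda>x. f x / k) \<le> 1}"
    using a M(1) unfolding iff by auto
  then have "{k. k > 0 \<and> modular \<Psi> X (\<lambda>x. f x / k) \<le> 1} \<noteq> {}"
    by blast
  from cInf_lessD[OF this assms(2)[unfolded gauge_norm_def]] show ?thesis
    using that by blast
qed

text \<open>If \<open>\<rho>\<^sub>\<Phi>(f / k) \<le> 1\<close>, then \<open>f / k\<close> is bounded by a constant \<open>M\<close> that depends only on \<open>\<Phi>\<close>. Hence
  \<open>k\<^sub>0 f / k\<close> takes its values where \<open>\<Psi>\<close> and \<open>\<Phi>\<close> agree, for \<open>k\<^sub>0 = min 1 (r / M)\<close>, and convexity gives
  \<open>\<rho>\<^sub>\<Psi>(f) \<le> (k / k\<^sub>0) \<rho>\<^sub>\<Phi>(f / k)\<close>.\<close>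

lemma small_gauge_imp_small_modular:
  assumes "young \<Phi>" "young \<Psi>" and agree: "\<And>x. \<bar>x\<bar> \<le> r \<Longrightarrow> \<Psi> x = \<Phi> x" and "0 < r" "0 < e"
  obtains d where "0 < d" "\<And>k X f. 0 < k \<Longrightarrow> k < d \<Longrightarrow> modular \<Phi> X (\<lambda>x. f x / k) \<le> 1 \<Longrightarrow>
    (\<lambda>x. \<Psi> (f x)) summable_on X \<and> (\<Sum>\<^sub>\<infinity>x\<in>X. \<Psi> (f x)) \<le> e"
proof -
  interpret \<Phi>: young \<Phi> by fact
  interpret \<Psi>: young \<Psi> by fact
  define M where "M = 1 + 1 / \<Phi> 1"
  define k0 where "k0 = min 1 (r / M)"
  have M: "0 < M"
    using \<Phi>.pos[of 1] by (simp add: M_def add_pos_pos)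
  have k0: "0 < k0" "k0 \<le> 1" "k0 * M \<le> r"
    using M \<open>0 < r\<close> by (auto simp: k0_def min_def field_simps)
  show ?thesis
  proof
    show "0 < k0 * min 1 e"
      using k0 \<open>0 < e\<close> by simp
    fix k X and f :: "'c \<Rightarrow> real"
    assume k: "0 < k" "k < k0 * min 1 e" and mod: "modular \<Phi> X (\<lambda>x. f x / k) \<le> 1"
    define t where "t = k / k0"
    have t: "0 \<le> t" "t \<le> 1" "t \<le> e"
    proof -
      have "t < min 1 e"
        unfolding t_def pos_divide_less_eq[OF k0(1)] using k(2) by (simp only: mult.commute)
      then show "t \<le> 1" "t \<le> e" by auto
    qed (use k k0 in \<open>simp add: t_def\<close>)
    have fin: "(\<Sum>x\<in>F. \<Phi> (f x / k)) \<le> 1" if "finite F" "F \<subseteq> X" for F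
      using mod modular_le_iff[of \<Phi> 1 X] that by simp
    have "(\<Sum>x\<in>F. \<Psi> (f x)) \<le> e" if F: "finite F" "F \<subseteq> X" for F
    proof -
      have "\<Psi> (f x) \<le> t * \<Phi> (f x / k)" if x: "x \<in> F" for x
      proof -
        have "\<bar>f x / k\<bar> \<le> M"
          unfolding M_def using fin[of "{x}"] F x by (intro \<Phi>.abs_le_of_le) auto
        then have "k0 * \<bar>f x / k\<bar> \<le> k0 * M"
          using k0 by (intro mult_left_mono) auto
        then have small: "\<bar>k0 * (f x / k)\<bar> \<le> r"
          using k0 by (simp add: abs_mult)
        have "\<Psi> (f x) = \<Psi> (t * (k0 * (f x / k)))"
          using k k0 by (simp add: t_def)
        also have "\<dots> \<le> t * \<Psi> (k0 * (f x / k))"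
          by (rule \<Psi>.scale_le[OF t(1,2)])
        also have "\<dots> = t * \<Phi> (k0 * (f x / k))"
          using agree[OF small] by simp
        also have "\<dots> \<le> t * \<Phi> (f x / k)"
          using t k0 by (intro mult_left_mono \<Phi>.mono)
            (simp_all only: abs_mult abs_of_pos[OF k0(1)], simp add: mult_left_le_one_le del: abs_divide)
        finally show ?thesis .
      qed
      then have "(\<Sum>x\<in>F. \<Psi> (f x)) \<le> t * (\<Sum>x\<in>F. \<Phi> (f x / k))"
        unfolding sum_distrib_left by (rule sum_mono)
      also have "\<dots> \<le> t * 1"
        using t fin[OF F] by (intro mult_left_mono) auto
      finally show ?thesis using t by simp
    qed
    then show "(\<lambda>x. \<Psi> (f x)) summable_on X \<and> (\<Sum>\<^sub>\<infinity>x\<in>X. \<Psi> (f x)) \<le> e"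
      by (intro conjI nonneg_summable_bounded_by) auto
  qed
qed

text \<open>The Orlicz space and its norm are those of \<open>\<Phi>\<close>, whereas all estimates are made with \<open>\<Psi>\<close>.\<close>

locale Orlicz_modification = \<Phi>: young \<Phi> + doubling_young \<Psi> K
  for \<Phi> \<Psi> :: "real \<Rightarrow> real" and K +
  fixes r :: real
  assumes agree: "\<bar>x\<bar> \<le> r \<Longrightarrow> \<Psi> x = \<Phi> x" and r_pos: "0 < r"
begin

lemma orlicz_space_iff:
  "f \<in> orlicz_space \<Phi> X \<longleftrightarrow> (\<forall>x. x \<notin> X \<longrightarrow> f x = 0) \<and> (\<lambda>x. \<Psi> (f x)) summable_on X"
proof -
  have "(\<lambda>x. \<Psi> (f x)) summable_on X" if a: "0 < a" "modular \<Phi> X (\<lambda>x. a * f x) < \<infinity>" for a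
  proof -
    have "(\<lambda>x. \<Phi> (a * f x)) summable_on X"
      using a(2) modular_finite_iff[of \<Phi> X "\<lambda>x. a * f x"] by simp
    then have s: "(\<lambda>x. \<Psi> (a * f x)) summable_on X"
      by (rule summable_of_agree_near_0[OF \<Phi>.young_axioms _ r_pos, rotated]) (rule agree)
    obtain C where C: "\<And>x. \<Psi> (1 / a * x) \<le> C * \<Psi> x"
      using scale_bound by blast
    have "\<Psi> (f x) \<le> C * \<Psi> (a * f x)" for x
      using C[of "a * f x"] a by simp
    then show ?thesis
      by (intro summable_on_comparison_test[OF summable_on_cmult_right[OF s]]) auto
  qed
  moreover have "modular \<Phi> X (\<lambda>x. 1 * f x) < \<infinity>" if "(\<lambda>x. \<Psi> (f x)) summable_on X"
  proof -
    have "(\<lambda>x. \<Phi> (f x)) summable_on X"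
      by (rule summable_of_agree_near_0[OF young_axioms _ r_pos that]) (simp add: agree)
    then show ?thesis
      using modular_finite_iff[of \<Phi> X f] by simp
  qed
  ultimately show ?thesis
    unfolding orlicz_space_def using zero_less_one by blast
qed

lemma orlicz_space_zero [simp]: "0 \<in> orlicz_space \<Phi> X"
  by (simp add: orlicz_space_iff)

lemma summable_add:
  assumes "(\<lambda>x. \<Psi> (f x)) summable_on X" "(\<lambda>x. \<Psi> (g x)) summable_on X"
  shows "(\<lambda>x. \<Psi> (f x + g x)) summable_on X"
  by (rule summable_on_comparison_test[OF summable_on_cmult_right[OF summable_on_add[OF assms], of K]])
     (auto intro: add_le)

lemma orlicz_space_add:
  assumes "f \<in> orlicz_space \<Phi> X" "g \<in> orlicz_space \<Phi> X"
  shows "f + g \<in> orlicz_space \<Phi> X"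
  using assms by (auto simp: orlicz_space_iff summable_add)

lemma orlicz_space_uminus:
  assumes "f \<in> orlicz_space \<Phi> X"
  shows "- f \<in> orlicz_space \<Phi> X"
  using assms by (auto simp: orlicz_space_iff even)

lemma orlicz_space_diff:
  assumes "f \<in> orlicz_space \<Phi> X" "g \<in> orlicz_space \<Phi> X"
  shows "f - g \<in> orlicz_space \<Phi> X"
  using orlicz_space_add[OF assms(1) orlicz_space_uminus[OF assms(2)]] by simp

end

section \<open>Cocycles of nonamenable groups\<close>

lemma trivial_reduced_H1_imp_in_closure:
  assumes triv: "trivial_group (reduced_H1 G V nrm \<pi>)"
    and "0 \<in> V" and \<pi>0: "\<And>g. g \<in> carrier G \<Longrightarrow> \<pi> g 0 = 0"
    and b: "b \<in> cocycles G V \<pi>"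
  shows "b \<in> closed_coboundaries G V nrm \<pi>"
proof -
  let ?Z = "cocycle_group G V \<pi>" and ?B = "closed_coboundaries G V nrm \<pi>"
  have "0 \<in> coboundaries G V \<pi>"
    using \<open>0 \<in> V\<close> \<pi>0 by (auto simp: coboundaries_def cocycles_def)
  also have "\<dots> \<subseteq> ?B"
    unfolding closed_coboundaries_def
    by (rule closure_of_subset) (auto simp: coboundaries_def)
  finally have "0 \<in> ?B" .
  then have "b \<in> r_coset ?Z ?B b"
    by (auto simp: r_coset_def cocycle_group_def intro: bexI[of _ 0])
  also have "r_coset ?Z ?B b = ?B"
    using triv b unfolding trivial_group_def reduced_H1_def carrier_FactGroup one_FactGroup
    by (auto simp: cocycle_group_def)
  finally show ?thesis .
qed

context Orlicz_modification
begin

lemma summable_translate: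
  fixes f :: "'g \<Rightarrow> real"
  assumes "group G" "g \<in> carrier G" "(\<lambda>x. \<Psi> (f x)) summable_on carrier G"
  shows "(\<lambda>x. \<Psi> (f (inv\<^bsub>G\<^esub> g \<otimes>\<^bsub>G\<^esub> x))) summable_on carrier G"
  using assms summable_on_reindex_bij_betw[OF bij_betw_left_translation, of G "inv\<^bsub>G\<^esub> g" "\<lambda>x. \<Psi> (f x)"]
  by (simp add: group.inv_closed)

lemma left_regular_in_orlicz_space:
  assumes "group G" "g \<in> carrier G" "f \<in> orlicz_space \<Phi> (carrier G)"
  shows "left_regular G g f \<in> orlicz_space \<Phi> (carrier G)"
  using summable_translate[of G g f] assms
  by (auto simp: orlicz_space_iff left_regular_def cong: summable_on_cong)

text \<open>The set \<open>U\<close> of all cocycles at gauge distance less than \<open>d\<close> from \<open>b\<close> on \<open>F\<close> is a neighbourhood of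
  \<open>b\<close>, so it contains a coboundary; \<open>d\<close> is chosen such that gauge distance less than \<open>d\<close> means modular
  at most \<open>e\<close>. Describing \<open>U\<close> by admissible scaling factors, not by the values of the norm,
  reduces its openness to \<open>modular_add_le_1\<close>.\<close>

lemma cocycle_approximation:
  fixes G :: "('g, 'm) monoid_scheme"
  defines "V \<equiv> orlicz_space \<Phi> (carrier G)"
  assumes "group G"
    and triv: "trivial_group (reduced_H1 G V (gauge_norm \<Phi> (carrier G)) (left_regular G))"
    and b: "b \<in> cocycles G V (left_regular G)"
    and F: "finite F" "F \<subseteq> carrier G" and "0 < e"
  obtains v where "v \<in> V"
    "\<And>g. g \<in> F \<Longrightarrow> (\<lambda>x. \<Psi> (v (inv\<^bsub>G\<^esub> g \<otimes>\<^bsub>G\<^esub> x) - v x - b g x)) summable_on carrier G"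
    "\<And>g. g \<in> F \<Longrightarrow> (\<Sum>\<^sub>\<infinity>x\<in>carrier G. \<Psi> (v (inv\<^bsub>G\<^esub> g \<otimes>\<^bsub>G\<^esub> x) - v x - b g x)) \<le> e"
proof -
  interpret group G by fact
  let ?X = "carrier G" and ?\<pi> = "left_regular G" and ?n = "gauge_norm \<Phi> (carrier G)"
  obtain d where d: "0 < d"
    and small: "\<And>k f. 0 < k \<Longrightarrow> k < d \<Longrightarrow> modular \<Phi> ?X (\<lambda>x. f x / k) \<le> 1 \<Longrightarrow>
      (\<lambda>x. \<Psi> (f x)) summable_on ?X \<and> (\<Sum>\<^sub>\<infinity>x\<in>?X. \<Psi> (f x)) \<le> e"
    using small_gauge_imp_small_modular[of \<Phi> \<Psi> r e, OF \<Phi>.young_axioms young_axioms _ r_pos \<open>0 < e\<close>]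
      agree by metis
  define U where "U = {c \<in> cocycles G V ?\<pi>.
    \<forall>g\<in>F. \<exists>k. 0 < k \<and> k < d \<and> modular \<Phi> ?X (\<lambda>x. (c g x - b g x) / k) \<le> 1}"
  have "openin (cocycle_topology G V ?n ?\<pi>) U"
    unfolding openin_cocycle_topology
  proof (intro conjI ballI)
    show "U \<subseteq> cocycles G V ?\<pi>" by (auto simp: U_def)
    fix c assume "c \<in> U"
    then have cZ: "c \<in> cocycles G V ?\<pi>"
      and "\<forall>g\<in>F. \<exists>k. 0 < k \<and> k < d \<and> modular \<Phi> ?X (\<lambda>x. (c g x - b g x) / k) \<le> 1"
      by (auto simp: U_def)
    then obtain k where k: "\<And>g. g \<in> F \<Longrightarrow> 0 < k g" "\<And>g. g \<in> F \<Longrightarrow> k g < d"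
        "\<And>g. g \<in> F \<Longrightarrow> modular \<Phi> ?X (\<lambda>x. (c g x - b g x) / k g) \<le> 1"
      by metis
    define \<epsilon> where "\<epsilon> = Min (insert 1 ((\<lambda>g. d - k g) ` F))"
    have \<epsilon>: "0 < \<epsilon>" "\<And>g. g \<in> F \<Longrightarrow> \<epsilon> \<le> d - k g"
      using F k by (auto simp: \<epsilon>_def)
    have "c' \<in> U" if c': "c' \<in> cocycles G V ?\<pi>" "\<forall>g\<in>F. ?n (c' g - c g) < \<epsilon>" for c'
    proof -
      have "\<exists>l. 0 < l \<and> l < d \<and> modular \<Phi> ?X (\<lambda>x. (c' g x - b g x) / l) \<le> 1" if g: "g \<in> F" for g
      proof -
        have "c' g \<in> V" "c g \<in> V"
          using g F c'(1) cZ by (auto simp: cocycles_def)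
        then have "c' g - c g \<in> orlicz_space \<Phi> ?X"
          unfolding V_def by (rule orlicz_space_diff)
        then obtain l where l: "0 < l" "l < \<epsilon>" "modular \<Phi> ?X (\<lambda>x. (c' g - c g) x / l) \<le> 1"
          using \<Phi>.gauge_norm_less_imp_modular_le_1[OF _ c'(2)[rule_format, OF g]] by blast
        have "modular \<Phi> ?X (\<lambda>x. ((c' g - c g) x + (c g x - b g x)) / (l + k g)) \<le> 1"
          using l k g by (intro \<Phi>.modular_add_le_1) auto
        then have "modular \<Phi> ?X (\<lambda>x. (c' g x - b g x) / (l + k g)) \<le> 1"
          by simp
        then show ?thesis
          using l k g \<epsilon>(2)[OF g] by (intro exI[of _ "l + k g"]) (auto simp: add_pos_pos)
      qed
      then show ?thesis
        using c'(1) by (simp add: U_def)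
    qed
    then show "\<exists>F \<epsilon>. finite F \<and> F \<subseteq> ?X \<and> \<epsilon> > 0 \<and>
        {c' \<in> cocycles G V ?\<pi>. \<forall>g\<in>F. ?n (c' g - c g) < \<epsilon>} \<subseteq> U"
      using F \<epsilon>(1) by blast
  qed
  moreover have "b \<in> U"
  proof -
    have "modular \<Phi> ?X (\<lambda>x. (b g x - b g x) / (d / 2)) \<le> 1" for g
      by (simp add: modular_def)
    then show ?thesis
      using b d unfolding U_def by (auto intro!: exI[of _ "d / 2"])
  qed
  moreover have "b \<in> closed_coboundaries G V ?n ?\<pi>"
    by (rule trivial_reduced_H1_imp_in_closure[OF triv _ _ b])
       (simp_all add: V_def left_regular_def fun_eq_iff)
  ultimately obtain c where c: "c \<in> coboundaries G V ?\<pi>" "c \<in> U"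
    unfolding closed_coboundaries_def in_closure_of by blast
  then obtain v where v: "v \<in> V" "\<And>g. g \<in> ?X \<Longrightarrow> c g = ?\<pi> g v - v"
    unfolding coboundaries_def by blast
  have "(\<lambda>x. \<Psi> (v (inv\<^bsub>G\<^esub> g \<otimes>\<^bsub>G\<^esub> x) - v x - b g x)) summable_on ?X \<and>
      (\<Sum>\<^sub>\<infinity>x\<in>?X. \<Psi> (v (inv\<^bsub>G\<^esub> g \<otimes>\<^bsub>G\<^esub> x) - v x - b g x)) \<le> e" if g: "g \<in> F" for g
  proof -
    obtain k where k: "0 < k" "k < d" "modular \<Phi> ?X (\<lambda>x. (c g x - b g x) / k) \<le> 1"
      using c(2) g unfolding U_def by blast
    have eq: "\<Psi> (c g x - b g x) = \<Psi> (v (inv\<^bsub>G\<^esub> g \<otimes>\<^bsub>G\<^esub> x) - v x - b g x)" if "x \<in> ?X" for x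
      using v(2)[of g] g F that by (auto simp: left_regular_def)
    have "(\<lambda>x. \<Psi> (c g x - b g x)) summable_on ?X \<and> (\<Sum>\<^sub>\<infinity>x\<in>?X. \<Psi> (c g x - b g x)) \<le> e"
      by (rule small[OF k])
    then show ?thesis
      using eq by (simp cong: summable_on_cong infsum_cong)
  qed
  then show ?thesis
    using that v(1) by blast
qed

text \<open>The function \<open>u = \<Psi> \<circ> f\<close> is not almost invariant in \<open>\<ell>\<^sup>1\<close>. By \<open>increment_bound\<close> its displacement
  \<open>|u(s\<inverse> x) - u(x)|\<close> is controlled by \<open>\<Psi> (f(s\<inverse> x) - f(x))\<close> up to a small multiple of \<open>u\<close> and its
  translate, which is absorbed on the left-hand side.\<close>

lemma nonamenable_imp_modular_gap:
  fixes G :: "('g, 'm) monoid_scheme"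
  assumes "group G" "countable (carrier G)" "\<not> amenable G"
  obtains S C where "finite S" "S \<subseteq> carrier G" "0 \<le> C"
    "\<And>f. (\<lambda>x. \<Psi> (f x)) summable_on carrier G \<Longrightarrow>
      (\<Sum>\<^sub>\<infinity>x\<in>carrier G. \<Psi> (f x))
        \<le> C * (\<Sum>s\<in>S. \<Sum>\<^sub>\<infinity>x\<in>carrier G. \<Psi> (f (inv\<^bsub>G\<^esub> s \<otimes>\<^bsub>G\<^esub> x) - f x))"
proof -
  interpret group G by fact
  let ?X = "carrier G"
  obtain S \<epsilon> where S: "finite S" "S \<subseteq> ?X" and \<epsilon>: "0 < \<epsilon>" and gap:
    "\<And>u :: 'g \<Rightarrow> real. (\<And>x. 0 \<le> u x) \<Longrightarrow> u summable_on ?X \<Longrightarrow>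
      \<epsilon> * infsum u ?X \<le> (\<Sum>s\<in>S. \<Sum>\<^sub>\<infinity>x\<in>?X. \<bar>u (inv\<^bsub>G\<^esub> s \<otimes>\<^bsub>G\<^esub> x) - u x\<bar>)"
    using nonamenable_imp_no_almost_invariant_vectors[OF assms] by blast
  \<comment> \<open>The terms with \<open>\<delta>\<close> add up to at most half of \<open>\<epsilon> * \<rho>\<close>; adding 1 covers the case of empty \<open>S\<close>.\<close>
  define \<delta> where "\<delta> = \<epsilon> / (4 * (real (card S) + 1))"
  have \<delta>: "0 < \<delta>" "2 * real (card S) * \<delta> \<le> \<epsilon> / 2"
    using \<epsilon> by (auto simp: \<delta>_def field_simps)
  obtain C where C: "0 \<le> C"
    "\<And>a b. \<bar>\<Psi> a - \<Psi> b\<bar> \<le> \<delta> * (\<Psi> a + \<Psi> b) + C * \<Psi> (a - b)"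
    using increment_bound[OF \<delta>(1)] by blast
  show ?thesis
  proof
    show "0 \<le> 2 * C / \<epsilon>"
      using C \<epsilon> by simp
    fix f :: "'g \<Rightarrow> real" assume s: "(\<lambda>x. \<Psi> (f x)) summable_on ?X"
    define \<rho> where "\<rho> = (\<Sum>\<^sub>\<infinity>x\<in>?X. \<Psi> (f x))"
    define D where "D = (\<lambda>s. \<Sum>\<^sub>\<infinity>x\<in>?X. \<Psi> (f (inv\<^bsub>G\<^esub> s \<otimes>\<^bsub>G\<^esub> x) - f x))"
    have \<rho>0: "0 \<le> \<rho>"
      unfolding \<rho>_def by (intro infsum_nonneg) auto
    have "(\<Sum>\<^sub>\<infinity>x\<in>?X. \<bar>\<Psi> (f (inv\<^bsub>G\<^esub> s \<otimes>\<^bsub>G\<^esub> x)) - \<Psi> (f x)\<bar>) \<le> 2 * \<delta> * \<rho> + C * D s"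
      if "s \<in> S" for s
    proof -
      let ?T = "\<lambda>x. inv\<^bsub>G\<^esub> s \<otimes>\<^bsub>G\<^esub> x"
      have sX: "s \<in> ?X" using that S by blast
      have st: "(\<lambda>x. \<Psi> (f (?T x))) summable_on ?X"
        by (rule summable_translate[OF \<open>group G\<close> sX s])
      have sd: "(\<lambda>x. \<Psi> (f (?T x) - f x)) summable_on ?X"
      proof (rule summable_on_comparison_test[OF summable_on_cmult_right[OF summable_on_add[OF st s], of K]])
        show "\<Psi> (f (?T x) - f x) \<le> K * (\<Psi> (f (?T x)) + \<Psi> (f x))" for x
          by (rule diff_le)
      qed simp
      have \<rho>t: "(\<Sum>\<^sub>\<infinity>x\<in>?X. \<Psi> (f (?T x))) = \<rho>"
        unfolding \<rho>_def using bij_betw_left_translation[OF \<open>group G\<close> inv_closed[OF sX]]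
        by (rule infsum_reindex_bij_betw)
      note s1 = summable_on_cmult_right[OF summable_on_add[OF st s], of \<delta>]
      note s2 = summable_on_cmult_right[OF sd, of C]
      have sa: "(\<lambda>x. \<bar>\<Psi> (f (?T x)) - \<Psi> (f x)\<bar>) summable_on ?X"
        by (rule summable_on_comparison_test[OF summable_on_add[OF s1 s2]]) (use C(2) in auto)
      have "(\<Sum>\<^sub>\<infinity>x\<in>?X. \<bar>\<Psi> (f (?T x)) - \<Psi> (f x)\<bar>)
          \<le> (\<Sum>\<^sub>\<infinity>x\<in>?X. \<delta> * (\<Psi> (f (?T x)) + \<Psi> (f x)) + C * \<Psi> (f (?T x) - f x))"
        by (rule infsum_mono[OF sa summable_on_add[OF s1 s2]]) (rule C(2))
      also have "\<dots> = \<delta> * (\<rho> + \<rho>) + C * D s"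
        unfolding infsum_add[OF s1 s2] infsum_cmult_right' infsum_add[OF st s] \<rho>t
        by (simp add: \<rho>_def D_def)
      finally show ?thesis by simp
    qed
    then have "(\<Sum>s\<in>S. \<Sum>\<^sub>\<infinity>x\<in>?X. \<bar>\<Psi> (f (inv\<^bsub>G\<^esub> s \<otimes>\<^bsub>G\<^esub> x)) - \<Psi> (f x)\<bar>)
        \<le> (\<Sum>s\<in>S. 2 * \<delta> * \<rho> + C * D s)"
      by (rule sum_mono)
    also have "\<dots> = 2 * real (card S) * \<delta> * \<rho> + C * sum D S"
      by (simp add: sum.distrib sum_distrib_left)
    also have "\<dots> \<le> \<epsilon> / 2 * \<rho> + C * sum D S"
      using \<delta>(2) \<rho>0 by (intro add_right_mono mult_right_mono)
    finally have "\<epsilon> * \<rho> \<le> \<epsilon> / 2 * \<rho> + C * sum D S"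
      using gap[of "\<lambda>x. \<Psi> (f x)"] s by (simp add: \<rho>_def)
    then show "\<rho> \<le> 2 * C / \<epsilon> * sum D S"
      using \<epsilon> by (simp add: field_simps)
  qed (use S in auto)
qed

text \<open>Take \<open>v n\<close> whose coboundary is within \<open>1 / (n + 1)\<close> of \<open>b\<close> on \<open>S\<close> and on the \<open>n\<close>-th set of an
  increasing sequence of finite sets that exhausts the group. The gap inequality bounds their modulars, hence the functions themselves, and a
  pointwise cluster point \<open>w\<close> has modular bounded by the same constant and coboundary \<open>b\<close>. The
  estimate for \<open>w\<close> is then the gap inequality once more. The constants come from the gap and do not
  depend on \<open>b\<close>.\<close>

lemma cocycle_is_bounded_coboundary:
  fixes G :: "('g, 'm) monoid_scheme"
  defines "V \<equiv> orlicz_space \<Phi> (carrier G)"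
  assumes "group G" and cnt: "countable (carrier G)" and "\<not> amenable G"
    and triv: "trivial_group (reduced_H1 G V (gauge_norm \<Phi> (carrier G)) (left_regular G))"
  obtains S C where "finite S" "S \<subseteq> carrier G" "0 \<le> C"
    "\<And>b. b \<in> cocycles G V (left_regular G) \<Longrightarrow>
      \<exists>v\<in>V. (\<forall>g\<in>carrier G. \<forall>x\<in>carrier G. b g x = v (inv\<^bsub>G\<^esub> g \<otimes>\<^bsub>G\<^esub> x) - v x) \<and>
        (\<Sum>\<^sub>\<infinity>x\<in>carrier G. \<Psi> (v x)) \<le> C * (\<Sum>s\<in>S. \<Sum>\<^sub>\<infinity>x\<in>carrier G. \<Psi> (b s x))"
proof -
  interpret group G by fact
  let ?X = "carrier G"
  obtain S C where S: "finite S" "S \<subseteq> ?X" and C: "0 \<le> C" and gap: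
    "\<And>f. (\<lambda>x. \<Psi> (f x)) summable_on ?X \<Longrightarrow> (\<Sum>\<^sub>\<infinity>x\<in>?X. \<Psi> (f x))
        \<le> C * (\<Sum>s\<in>S. \<Sum>\<^sub>\<infinity>x\<in>?X. \<Psi> (f (inv\<^bsub>G\<^esub> s \<otimes>\<^bsub>G\<^esub> x) - f x))"
    using nonamenable_imp_modular_gap[OF assms(2-4)] by blast
  define e where "e = from_nat_into ?X"
  have e: "range e = ?X"
    unfolding e_def using cnt one_closed by (intro range_from_nat_into) auto
  have "\<exists>v\<in>V. (\<forall>g\<in>?X. \<forall>x\<in>?X. b g x = v (inv\<^bsub>G\<^esub> g \<otimes>\<^bsub>G\<^esub> x) - v x) \<and>
        (\<Sum>\<^sub>\<infinity>x\<in>?X. \<Psi> (v x)) \<le> C * (\<Sum>s\<in>S. \<Sum>\<^sub>\<infinity>x\<in>?X. \<Psi> (b s x))"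
    if b: "b \<in> cocycles G V (left_regular G)" for b
  proof -
    define E where "E = (\<lambda>v g x. v (inv\<^bsub>G\<^esub> g \<otimes>\<^bsub>G\<^esub> x) - v x - b g x)"
    have bs: "(\<lambda>x. \<Psi> (b g x)) summable_on ?X" if "g \<in> ?X" for g
      using b that by (auto simp: cocycles_def V_def orlicz_space_iff)
    have "\<exists>v. v \<in> V \<and> (\<forall>g\<in>S \<union> e ` {..n}. (\<lambda>x. \<Psi> (E v g x)) summable_on ?X \<and>
        (\<Sum>\<^sub>\<infinity>x\<in>?X. \<Psi> (E v g x)) \<le> 1 / real (Suc n))" for n
    proof -
      have "finite (S \<union> e ` {..n})" "S \<union> e ` {..n} \<subseteq> ?X" "0 < 1 / real (Suc n)"
        using S e by auto
      then show ?thesis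
        unfolding V_def E_def
        by (rule cocycle_approximation[OF \<open>group G\<close> triv[unfolded V_def] b[unfolded V_def]]) blast
    qed
    then obtain v where vV: "\<And>n. v n \<in> V"
      and Es: "\<And>n g. g \<in> S \<union> e ` {..n} \<Longrightarrow> (\<lambda>x. \<Psi> (E (v n) g x)) summable_on ?X"
      and E_le: "\<And>n g. g \<in> S \<union> e ` {..n} \<Longrightarrow> (\<Sum>\<^sub>\<infinity>x\<in>?X. \<Psi> (E (v n) g x)) \<le> 1 / real (Suc n)"
      by metis
    have vs: "(\<lambda>x. \<Psi> (v n x)) summable_on ?X" and v0: "x \<notin> ?X \<Longrightarrow> v n x = 0" for n x
      using vV[of n] by (auto simp: V_def orlicz_space_iff)
    define B where "B = C * (\<Sum>s\<in>S. K * (1 + (\<Sum>\<^sub>\<infinity>x\<in>?X. \<Psi> (b s x))))"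
    have bound: "(\<Sum>\<^sub>\<infinity>x\<in>?X. \<Psi> (v n x)) \<le> B" for n
    proof -
      have "(\<Sum>\<^sub>\<infinity>x\<in>?X. \<Psi> (v n (inv\<^bsub>G\<^esub> s \<otimes>\<^bsub>G\<^esub> x) - v n x))
          \<le> K * (1 + (\<Sum>\<^sub>\<infinity>x\<in>?X. \<Psi> (b s x)))" if s: "s \<in> S" for s
      proof -
        have sE: "(\<lambda>x. \<Psi> (E (v n) s x)) summable_on ?X" and sb: "(\<lambda>x. \<Psi> (b s x)) summable_on ?X"
          using Es[of s n] bs[of s] s S by auto
        note s' = summable_on_cmult_right[OF summable_on_add[OF sE sb], of K]
        have le: "\<Psi> (v n (inv\<^bsub>G\<^esub> s \<otimes>\<^bsub>G\<^esub> x) - v n x) \<le> K * (\<Psi> (E (v n) s x) + \<Psi> (b s x))" for x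
          using add_le[of "E (v n) s x" "b s x"] by (simp add: E_def)
        have sv: "(\<lambda>x. \<Psi> (v n (inv\<^bsub>G\<^esub> s \<otimes>\<^bsub>G\<^esub> x) - v n x)) summable_on ?X"
          by (rule summable_on_comparison_test[OF s']) (use le in auto)
        have "(\<Sum>\<^sub>\<infinity>x\<in>?X. \<Psi> (v n (inv\<^bsub>G\<^esub> s \<otimes>\<^bsub>G\<^esub> x) - v n x))
            \<le> (\<Sum>\<^sub>\<infinity>x\<in>?X. K * (\<Psi> (E (v n) s x) + \<Psi> (b s x)))"
          by (rule infsum_mono[OF sv s']) (rule le)
        also have "\<dots> = K * ((\<Sum>\<^sub>\<infinity>x\<in>?X. \<Psi> (E (v n) s x)) + (\<Sum>\<^sub>\<infinity>x\<in>?X. \<Psi> (b s x)))"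
          by (simp add: infsum_cmult_right' infsum_add[OF sE sb])
        also have "\<dots> \<le> K * (1 + (\<Sum>\<^sub>\<infinity>x\<in>?X. \<Psi> (b s x)))"
        proof -
          have "1 / real (Suc n) \<le> 1"
            by simp
          then have "(\<Sum>\<^sub>\<infinity>x\<in>?X. \<Psi> (E (v n) s x)) \<le> 1"
            using E_le[OF UnI1[OF s], of n] by linarith
          then show ?thesis
            using K_nonneg by (intro mult_left_mono add_right_mono)
        qed
        finally show ?thesis .
      qed
      then have "C * (\<Sum>s\<in>S. \<Sum>\<^sub>\<infinity>x\<in>?X. \<Psi> (v n (inv\<^bsub>G\<^esub> s \<otimes>\<^bsub>G\<^esub> x) - v n x)) \<le> B"
        unfolding B_def using C by (intro mult_left_mono sum_mono)
      with gap[OF vs] show ?thesis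
        by (rule order_trans)
    qed
    have fin: "(\<Sum>x\<in>F. \<Psi> (v n x)) \<le> B" if "finite F" "F \<subseteq> ?X" for F n
      using order_trans[OF finite_sum_le_infsum[OF vs that] bound] by simp
    have "\<bar>v n x\<bar> \<le> 1 + B / \<Psi> 1" for n x
    proof (rule abs_le_of_le)
      have "0 \<le> B"
        using fin[of "{}"] by simp
      then show "\<Psi> (v n x) \<le> B"
        using fin[of "{x}" n] v0[of x n] by (cases "x \<in> ?X") auto
    qed
    then obtain w where
      w: "\<And>P. closed {h. P h} \<Longrightarrow> eventually (\<lambda>n. P (v n)) sequentially \<Longrightarrow> P w"
      using pointwise_cluster_point[of v "\<lambda>_. 1 + B / \<Psi> 1"] by blast
    have cont: "continuous_on UNIV (\<lambda>h. \<Psi> (f h))" if "continuous_on UNIV f" for f :: "('g \<Rightarrow> real) \<Rightarrow> real"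
      using continuous_on_compose2[OF continuous[of UNIV] that] by simp
    note conts = continuous_on_product_coordinates continuous_intros cont
    have "w x = 0" if "x \<notin> ?X" for x
      by (rule w) (use v0[OF that] in \<open>auto intro!: closed_Collect_eq conts\<close>)
    moreover have "(\<Sum>x\<in>F. \<Psi> (w x)) \<le> B" if "finite F" "F \<subseteq> ?X" for F
      by (rule w) (use fin[OF that] in \<open>auto intro!: closed_Collect_le conts\<close>)
    then have ws: "(\<lambda>x. \<Psi> (w x)) summable_on ?X"
      by (intro nonneg_summable_bounded_by(1)) auto
    ultimately have wV: "w \<in> V"
      by (auto simp: V_def orlicz_space_iff)
    have wb: "b g x = w (inv\<^bsub>G\<^esub> g \<otimes>\<^bsub>G\<^esub> x) - w x" if g: "g \<in> ?X" and x: "x \<in> ?X" for g x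
    proof -
      obtain k where k: "e k = g"
        using e g by (metis rangeE)
      have "\<Psi> (E w g x) \<le> 0 + \<epsilon>" if "0 < \<epsilon>" for \<epsilon>
      proof (rule w)
        obtain j where j: "1 / real (Suc j) < \<epsilon>"
          using \<open>0 < \<epsilon>\<close> nat_approx_posE by blast
        have "\<Psi> (E (v n) g x) \<le> 0 + \<epsilon>" if n: "max j k \<le> n" for n
        proof -
          have gn: "g \<in> S \<union> e ` {..n}"
            using k n by auto
          have "\<Psi> (E (v n) g x) \<le> (\<Sum>\<^sub>\<infinity>x\<in>?X. \<Psi> (E (v n) g x))"
            using finite_sum_le_infsum[OF Es[OF gn], of "{x}"] x by simp
          also have "\<dots> \<le> 1 / real (Suc n)"
            by (rule E_le[OF gn])
          also have "\<dots> \<le> 1 / real (Suc j)"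
            using n by (intro divide_left_mono) auto
          finally show ?thesis using j by simp
        qed
        then show "eventually (\<lambda>n. \<Psi> (E (v n) g x) \<le> 0 + \<epsilon>) sequentially"
          unfolding eventually_sequentially by blast
        show "closed {h. \<Psi> (E h g x) \<le> 0 + \<epsilon>}"
          unfolding E_def by (intro closed_Collect_le conts)
      qed
      then have "\<Psi> (E w g x) \<le> 0"
        by (rule field_le_epsilon)
      then have "E w g x = 0"
        using pos[of "E w g x"] by (auto simp: not_less[symmetric])
      then show ?thesis
        by (simp add: E_def)
    qed
    have "(\<Sum>\<^sub>\<infinity>x\<in>?X. \<Psi> (w x)) \<le> C * (\<Sum>s\<in>S. \<Sum>\<^sub>\<infinity>x\<in>?X. \<Psi> (b s x))"
    proof -
      have "(\<Sum>\<^sub>\<infinity>x\<in>?X. \<Psi> (w (inv\<^bsub>G\<^esub> s \<otimes>\<^bsub>G\<^esub> x) - w x)) = (\<Sum>\<^sub>\<infinity>x\<in>?X. \<Psi> (b s x))" if "s \<in> S" for s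
        using wb S that by (intro infsum_cong) auto
      then show ?thesis
        using gap[OF ws] by simp
    qed
    with wV wb show ?thesis by blast
  qed
  then show ?thesis
    using that S C by blast
qed

section \<open>From the subgroup to the whole group\<close>

text \<open>As an \<open>H\<close>-module, the space of functions on the right coset \<open>H y\<close> is the left regular
  representation of \<open>H\<close>, by means of the bijection \<open>z \<mapsto> z y\<close>.\<close>

lemma translated_restriction_cocycle:
  fixes G :: "('g, 'm) monoid_scheme" and H :: "'g set"
  defines "c \<equiv> \<lambda>b y h z. if h \<in> H \<and> z \<in> H then b h (z \<otimes>\<^bsub>G\<^esub> y) else (0::real)"
  assumes "group G" "subgroup H G" and y: "y \<in> carrier G"
    and b: "b \<in> cocycles G (orlicz_space \<Phi> (carrier G)) (left_regular G)"
  shows "c b y \<in> cocycles (G\<lparr>carrier := H\<rparr>) (orlicz_space \<Phi> H) (left_regular (G\<lparr>carrier := H\<rparr>))"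
    and "h \<in> H \<Longrightarrow> (\<Sum>\<^sub>\<infinity>z\<in>H. \<Psi> (c b y h z)) = (\<Sum>\<^sub>\<infinity>x\<in>H #>\<^bsub>G\<^esub> y. \<Psi> (b h x))"
proof -
  interpret group G by fact
  interpret H: subgroup H G by fact
  have inj: "inj_on (\<lambda>z. z \<otimes>\<^bsub>G\<^esub> y) H"
    by (rule inj_on_g[OF H.subset y])
  have img: "H #>\<^bsub>G\<^esub> y = (\<lambda>z. z \<otimes>\<^bsub>G\<^esub> y) ` H"
    by (auto simp: r_coset_def)
  have coset_sub: "H #>\<^bsub>G\<^esub> y \<subseteq> carrier G"
    by (rule r_coset_subset_G[OF H.subset y])
  have bG: "b g \<in> orlicz_space \<Phi> (carrier G)" if "g \<in> carrier G" for g
    using b that by (auto simp: cocycles_def)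
  have "c b y h \<in> orlicz_space \<Phi> H" if h: "h \<in> H" for h
  proof -
    have "(\<lambda>x. \<Psi> (b h x)) summable_on (H #>\<^bsub>G\<^esub> y)"
      using bG[of h] h summable_on_subset_banach[OF _ coset_sub] by (auto simp: orlicz_space_iff)
    then have "(\<lambda>z. \<Psi> (b h (z \<otimes>\<^bsub>G\<^esub> y))) summable_on H"
      using summable_on_reindex[OF inj, of "\<lambda>x. \<Psi> (b h x)"] by (simp add: img o_def)
    then show ?thesis
      using h by (auto simp: c_def orlicz_space_iff cong: summable_on_cong)
  qed
  moreover have "c b y (h \<otimes>\<^bsub>G\<^esub> k) = c b y h + left_regular (G\<lparr>carrier := H\<rparr>) h (c b y k)"
    if hk: "h \<in> H" "k \<in> H" for h k
  proof
    fix z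
    have "b (h \<otimes>\<^bsub>G\<^esub> k) = b h + left_regular G h (b k)"
      using b hk H.subset by (auto simp: cocycles_def)
    then show "c b y (h \<otimes>\<^bsub>G\<^esub> k) z = (c b y h + left_regular (G\<lparr>carrier := H\<rparr>) h (c b y k)) z"
      using hk y by (auto simp: c_def left_regular_def m_inv_consistent[OF \<open>subgroup H G\<close>] m_assoc)
  qed
  ultimately show "c b y \<in> cocycles (G\<lparr>carrier := H\<rparr>) (orlicz_space \<Phi> H) (left_regular (G\<lparr>carrier := H\<rparr>))"
    by (auto simp: cocycles_def c_def fun_eq_iff)
  show "(\<Sum>\<^sub>\<infinity>z\<in>H. \<Psi> (c b y h z)) = (\<Sum>\<^sub>\<infinity>x\<in>H #>\<^bsub>G\<^esub> y. \<Psi> (b h x))" if "h \<in> H"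
    unfolding img infsum_reindex[OF inj] using that by (intro infsum_cong) (simp add: c_def)
qed

text \<open>Solve the problem on each right coset \<open>H y\<close> separately, for a fixed representative \<open>y\<close>, by a function
  \<open>v y\<close> on \<open>H\<close>. The bounds on the modulars of the \<open>v y\<close> involve the parts of \<open>b s\<close> on disjoint cosets
  with one common constant, so they sum to a multiple of the total modular of the \<open>b s\<close> with
  \<open>s \<in> S\<close>.\<close>

lemma restriction_is_coboundary:
  fixes G :: "('g, 'm) monoid_scheme"
  assumes "group G" "countable (carrier G)" "subgroup H G" "\<not> amenable (G\<lparr>carrier := H\<rparr>)"
    and triv: "trivial_group (reduced_H1 (G\<lparr>carrier := H\<rparr>) (orlicz_space \<Phi> H) (gauge_norm \<Phi> H)
           (left_regular (G\<lparr>carrier := H\<rparr>)))"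
    and b: "b \<in> cocycles G (orlicz_space \<Phi> (carrier G)) (left_regular G)"
  obtains f where "f \<in> orlicz_space \<Phi> (carrier G)" "\<And>h. h \<in> H \<Longrightarrow> b h = left_regular G h f - f"
proof -
  interpret group G by fact
  interpret H: subgroup H G by fact
  let ?X = "carrier G" and ?H = "G\<lparr>carrier := H\<rparr>"
  have "group ?H" "countable (carrier ?H)"
    using H.subgroup_is_group[OF \<open>group G\<close>] assms(2) H.subset countable_subset by auto
  moreover have "trivial_group (reduced_H1 ?H (orlicz_space \<Phi> (carrier ?H))
      (gauge_norm \<Phi> (carrier ?H)) (left_regular ?H))"
    using triv by simp
  ultimately obtain S C where S: "finite S" "S \<subseteq> carrier ?H" and C: "0 \<le> C" and bounded:
    "\<And>c. c \<in> cocycles ?H (orlicz_space \<Phi> (carrier ?H)) (left_regular ?H) \<Longrightarrow>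
      \<exists>v\<in>orlicz_space \<Phi> (carrier ?H).
        (\<forall>h\<in>carrier ?H. \<forall>z\<in>carrier ?H. c h z = v (inv\<^bsub>?H\<^esub> h \<otimes>\<^bsub>?H\<^esub> z) - v z) \<and>
        (\<Sum>\<^sub>\<infinity>z\<in>carrier ?H. \<Psi> (v z)) \<le> C * (\<Sum>s\<in>S. \<Sum>\<^sub>\<infinity>z\<in>carrier ?H. \<Psi> (c s z))"
    using cocycle_is_bounded_coboundary[of ?H] assms(4) by blast
  have sb: "(\<lambda>x. \<Psi> (b h x)) summable_on ?X" if "h \<in> H" for h
    using b that by (auto simp: cocycles_def orlicz_space_iff)
  have "\<exists>v. v \<in> orlicz_space \<Phi> H \<and>
      (\<forall>h\<in>H. \<forall>z\<in>H. b h (z \<otimes>\<^bsub>G\<^esub> y) = v (inv\<^bsub>G\<^esub> h \<otimes>\<^bsub>G\<^esub> z) - v z) \<and>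
      (\<Sum>\<^sub>\<infinity>z\<in>H. \<Psi> (v z)) \<le> C * (\<Sum>s\<in>S. \<Sum>\<^sub>\<infinity>x\<in>H #>\<^bsub>G\<^esub> y. \<Psi> (b s x))" if y: "y \<in> ?X" for y
  proof -
    let ?c = "\<lambda>h z. if h \<in> H \<and> z \<in> H then b h (z \<otimes>\<^bsub>G\<^esub> y) else 0"
    note tr = translated_restriction_cocycle[OF \<open>group G\<close> \<open>subgroup H G\<close> y b]
    obtain v where v: "v \<in> orlicz_space \<Phi> H"
      "\<And>h z. h \<in> H \<Longrightarrow> z \<in> H \<Longrightarrow> ?c h z = v (inv\<^bsub>?H\<^esub> h \<otimes>\<^bsub>G\<^esub> z) - v z"
      "(\<Sum>\<^sub>\<infinity>z\<in>H. \<Psi> (v z)) \<le> C * (\<Sum>s\<in>S. \<Sum>\<^sub>\<infinity>z\<in>H. \<Psi> (?c s z))"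
      using bounded[of ?c] tr(1) by auto
    have "(\<Sum>s\<in>S. \<Sum>\<^sub>\<infinity>z\<in>H. \<Psi> (?c s z)) = (\<Sum>s\<in>S. \<Sum>\<^sub>\<infinity>x\<in>H #>\<^bsub>G\<^esub> y. \<Psi> (b s x))"
      using tr(2) S by (intro sum.cong refl) (simp add: subset_iff)
    moreover have "b h (z \<otimes>\<^bsub>G\<^esub> y) = v (inv\<^bsub>G\<^esub> h \<otimes>\<^bsub>G\<^esub> z) - v z" if "h \<in> H" "z \<in> H" for h z
      using v(2)[OF that] that by (simp add: m_inv_consistent[OF \<open>subgroup H G\<close>])
    ultimately show ?thesis
      using v(1,3) by auto
  qed
  then obtain v where vV: "\<And>y. y \<in> ?X \<Longrightarrow> v y \<in> orlicz_space \<Phi> H"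
    and vb: "\<And>y h z. y \<in> ?X \<Longrightarrow> h \<in> H \<Longrightarrow> z \<in> H \<Longrightarrow>
      b h (z \<otimes>\<^bsub>G\<^esub> y) = v y (inv\<^bsub>G\<^esub> h \<otimes>\<^bsub>G\<^esub> z) - v y z"
    and v_le: "\<And>y. y \<in> ?X \<Longrightarrow>
      (\<Sum>\<^sub>\<infinity>z\<in>H. \<Psi> (v y z)) \<le> C * (\<Sum>s\<in>S. \<Sum>\<^sub>\<infinity>x\<in>H #>\<^bsub>G\<^esub> y. \<Psi> (b s x))"
    by metis
  define \<rho> where "\<rho> = (\<lambda>x. SOME y. y \<in> H #>\<^bsub>G\<^esub> x)"
  have \<rho>: "\<rho> x \<in> H #>\<^bsub>G\<^esub> x" if "x \<in> ?X" for x
    unfolding \<rho>_def by (rule someI[of _ x]) (rule rcos_self[OF that \<open>subgroup H G\<close>])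
  have \<rho>X: "\<rho> x \<in> ?X" if "x \<in> ?X" for x
    using \<rho>[OF that] r_coset_subset_G[OF H.subset that] by blast
  have \<rho>_coset: "H #>\<^bsub>G\<^esub> \<rho> x = H #>\<^bsub>G\<^esub> x" if "x \<in> ?X" for x
    using repr_independence[OF \<rho>[OF that] that \<open>subgroup H G\<close>] by simp
  have \<rho>_eq: "\<rho> x = \<rho> y" if "H #>\<^bsub>G\<^esub> x = H #>\<^bsub>G\<^esub> y" for x y
    using that by (simp add: \<rho>_def)
  have quot: "x \<otimes>\<^bsub>G\<^esub> inv\<^bsub>G\<^esub> (\<rho> x) \<in> H" if x: "x \<in> ?X" for x
    using H.rcos_module[OF \<open>group G\<close> \<rho>X[OF x] x] rcos_self[OF x \<open>subgroup H G\<close>] \<rho>_coset[OF x] by simp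
  define f where "f = (\<lambda>x. if x \<in> ?X then v (\<rho> x) (x \<otimes>\<^bsub>G\<^esub> inv\<^bsub>G\<^esub> (\<rho> x)) else 0)"
  have "(\<Sum>x\<in>F. \<Psi> (f x)) \<le> C * (\<Sum>s\<in>S. \<Sum>\<^sub>\<infinity>x\<in>?X. \<Psi> (b s x))" if F: "finite F" "F \<subseteq> ?X" for F
  proof -
    have coset_sum: "(\<Sum>x\<in>{x \<in> F. \<rho> x = y}. \<Psi> (f x))
        \<le> C * (\<Sum>s\<in>S. \<Sum>\<^sub>\<infinity>x\<in>H #>\<^bsub>G\<^esub> y. \<Psi> (b s x))" if y: "y \<in> \<rho> ` F" for y
    proof -
      have yX: "y \<in> ?X"
        using y F \<rho>X by auto
      let ?F = "{x \<in> F. \<rho> x = y}" and ?q = "\<lambda>x. x \<otimes>\<^bsub>G\<^esub> inv\<^bsub>G\<^esub> y"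
      have sub: "?F \<subseteq> ?X" using F by auto
      have "(\<Sum>x\<in>?F. \<Psi> (f x)) = (\<Sum>x\<in>?F. \<Psi> (v y (?q x)))"
        using F by (intro sum.cong) (auto simp: f_def)
      also have "\<dots> = (\<Sum>z\<in>?q ` ?F. \<Psi> (v y z))"
        using inj_on_g[OF sub inv_closed[OF yX]] by (simp add: sum.reindex o_def)
      also have "\<dots> \<le> (\<Sum>\<^sub>\<infinity>z\<in>H. \<Psi> (v y z))"
        using vV[OF yX] F quot by (intro finite_sum_le_infsum) (auto simp: orlicz_space_iff)
      also have "\<dots> \<le> C * (\<Sum>s\<in>S. \<Sum>\<^sub>\<infinity>x\<in>H #>\<^bsub>G\<^esub> y. \<Psi> (b s x))"
        by (rule v_le[OF yX])
      finally show ?thesis .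
    qed
    have cosets: "(\<Sum>y\<in>\<rho> ` F. \<Sum>\<^sub>\<infinity>x\<in>H #>\<^bsub>G\<^esub> y. \<Psi> (b s x)) \<le> (\<Sum>\<^sub>\<infinity>x\<in>?X. \<Psi> (b s x))" if s: "s \<in> S" for s
    proof -
      have sub: "H #>\<^bsub>G\<^esub> y \<subseteq> ?X" if "y \<in> \<rho> ` F" for y
        using that F \<rho>X by (intro r_coset_subset_G[OF H.subset]) auto
      have sbX: "(\<lambda>x. \<Psi> (b s x)) summable_on ?X"
        using s S by (intro sb) (simp add: subset_iff)
      have disj: "(H #>\<^bsub>G\<^esub> y) \<inter> (H #>\<^bsub>G\<^esub> y') = {}" if reps: "y \<in> \<rho> ` F" "y' \<in> \<rho> ` F" and ne: "y \<noteq> y'" for y y'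
      proof (rule ccontr)
        assume "(H #>\<^bsub>G\<^esub> y) \<inter> (H #>\<^bsub>G\<^esub> y') \<noteq> {}"
        then obtain z where z: "z \<in> H #>\<^bsub>G\<^esub> y" "z \<in> H #>\<^bsub>G\<^esub> y'" by blast
        obtain x x' where x: "x \<in> F" "y = \<rho> x" and x': "x' \<in> F" "y' = \<rho> x'"
          using reps by auto
        have xX: "x \<in> ?X" "x' \<in> ?X"
          using x x' F by auto
        have "z \<in> H #>\<^bsub>G\<^esub> x" "z \<in> H #>\<^bsub>G\<^esub> x'"
          using z \<rho>_coset xX x x' by simp_all
        then have "H #>\<^bsub>G\<^esub> x = H #>\<^bsub>G\<^esub> z" "H #>\<^bsub>G\<^esub> x' = H #>\<^bsub>G\<^esub> z"
          using xX \<open>subgroup H G\<close> by (metis repr_independence)+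
        then show False
          using \<rho>_eq[of x x'] x x' ne by simp
      qed
      have "(\<Sum>y\<in>\<rho> ` F. \<Sum>\<^sub>\<infinity>x\<in>H #>\<^bsub>G\<^esub> y. \<Psi> (b s x)) = (\<Sum>\<^sub>\<infinity>x\<in>(\<Union>y\<in>\<rho> ` F. H #>\<^bsub>G\<^esub> y). \<Psi> (b s x))"
        using F disj by (intro sum_infsum summable_on_subset_banach[OF sbX sub]) auto
      also have "\<dots> \<le> (\<Sum>\<^sub>\<infinity>x\<in>?X. \<Psi> (b s x))"
      proof -
        have "(\<Union>y\<in>\<rho> ` F. H #>\<^bsub>G\<^esub> y) \<subseteq> ?X"
          using sub by blast
        then show ?thesis
          by (intro infsum_mono2 sbX summable_on_subset_banach[OF sbX]) auto
      qed
      finally show ?thesis .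
    qed
    have "(\<Sum>x\<in>F. \<Psi> (f x)) = (\<Sum>y\<in>\<rho> ` F. \<Sum>x\<in>{x \<in> F. \<rho> x = y}. \<Psi> (f x))"
      by (rule sum.image_gen[OF F(1)])
    also have "\<dots> \<le> (\<Sum>y\<in>\<rho> ` F. C * (\<Sum>s\<in>S. \<Sum>\<^sub>\<infinity>x\<in>H #>\<^bsub>G\<^esub> y. \<Psi> (b s x)))"
      by (rule sum_mono) (rule coset_sum)
    also have "\<dots> = C * (\<Sum>s\<in>S. \<Sum>y\<in>\<rho> ` F. \<Sum>\<^sub>\<infinity>x\<in>H #>\<^bsub>G\<^esub> y. \<Psi> (b s x))"
      by (subst sum.swap) (simp only: sum_distrib_left)
    also have "\<dots> \<le> C * (\<Sum>s\<in>S. \<Sum>\<^sub>\<infinity>x\<in>?X. \<Psi> (b s x))"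
      by (intro mult_left_mono sum_mono cosets C)
    finally show ?thesis .
  qed
  then have "(\<lambda>x. \<Psi> (f x)) summable_on ?X"
    by (intro nonneg_summable_bounded_by(1)) auto
  then have "f \<in> orlicz_space \<Phi> ?X"
    by (auto simp: orlicz_space_iff f_def)
  moreover have "b h = left_regular G h f - f" if h: "h \<in> H" for h
  proof
    fix x
    show "b h x = (left_regular G h f - f) x"
    proof (cases "x \<in> ?X")
      case False
      have "b h \<in> orlicz_space \<Phi> ?X"
        using b h by (auto simp: cocycles_def)
      then show ?thesis
        using False by (simp add: orlicz_space_iff left_regular_def f_def)
    next
      case x: True
      have ih: "inv\<^bsub>G\<^esub> h \<in> H" "h \<in> ?X"
        using h by auto
      let ?x = "inv\<^bsub>G\<^esub> h \<otimes>\<^bsub>G\<^esub> x"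
      have "?x \<in> H #>\<^bsub>G\<^esub> x"
        by (rule rcosI[OF ih(1) H.subset x])
      then have "\<rho> ?x = \<rho> x"
        using repr_independence[OF _ x \<open>subgroup H G\<close>] by (intro \<rho>_eq) simp
      then have "f ?x = v (\<rho> x) (inv\<^bsub>G\<^esub> h \<otimes>\<^bsub>G\<^esub> (x \<otimes>\<^bsub>G\<^esub> inv\<^bsub>G\<^esub> (\<rho> x)))"
        using x ih \<rho>X[OF x] by (simp add: f_def m_assoc)
      moreover have "b h x = b h (x \<otimes>\<^bsub>G\<^esub> inv\<^bsub>G\<^esub> (\<rho> x) \<otimes>\<^bsub>G\<^esub> \<rho> x)"
        using x \<rho>X[OF x] by (simp add: m_assoc)
      ultimately show ?thesis
        using vb[OF \<rho>X[OF x] h quot[OF x]] x by (simp add: left_regular_def f_def)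
    qed
  qed
  ultimately show ?thesis
    using that by blast
qed

text \<open>Expanding both sides of \<open>b(n g) = b(g n')\<close> with \<open>n' = g\<inverse> n g \<in> N\<close> shows that \<open>b g\<close> is invariant under
  \<open>N\<close>. A nonzero value would thus be taken infinitely often, contradicting summability.\<close>

lemma cocycle_vanishing_on_infinite_normal_subgroup:
  fixes G :: "('g, 'm) monoid_scheme"
  assumes "N \<lhd> G" "infinite N"
    and b: "b \<in> cocycles G (orlicz_space \<Phi> (carrier G)) (left_regular G)"
    and bN: "\<And>n. n \<in> N \<Longrightarrow> b n = 0" and g: "g \<in> carrier G"
  shows "b g = 0"
proof
  interpret N: normal N G by fact
  let ?X = "carrier G"
  have coc: "b (h \<otimes>\<^bsub>G\<^esub> k) = b h + left_regular G h (b k)" if "h \<in> ?X" "k \<in> ?X" for h k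
    using b that by (auto simp: cocycles_def)
  have bg: "b g \<in> orlicz_space \<Phi> ?X"
    using b g by (auto simp: cocycles_def)
  have inv: "b g = left_regular G n (b g)" if n: "n \<in> N" for n
  proof -
    define n' where "n' = inv\<^bsub>G\<^esub> g \<otimes>\<^bsub>G\<^esub> n \<otimes>\<^bsub>G\<^esub> g"
    have n': "n' \<in> N"
      unfolding n'_def by (rule N.inv_op_closed1[OF g n])
    have nX: "n \<in> ?X" "n' \<in> ?X"
      using n n' by auto
    have "b n + left_regular G n (b g) = b (n \<otimes>\<^bsub>G\<^esub> g)"
      using coc nX g by simp
    also have "n \<otimes>\<^bsub>G\<^esub> g = g \<otimes>\<^bsub>G\<^esub> n'"
      using nX g by (simp add: n'_def flip: N.m_assoc)
    also have "b \<dots> = b g + left_regular G g (b n')"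
      using coc nX g by simp
    also have "left_regular G g (b n') = 0"
      by (simp add: bN[OF n'] left_regular_def fun_eq_iff)
    finally show ?thesis
      using bN[OF n] by simp
  qed
  fix x
  show "b g x = 0 x"
  proof (rule ccontr)
    assume "b g x \<noteq> 0 x"
    then have nz: "b g x \<noteq> 0" by simp
    then have x: "x \<in> ?X"
      using bg by (auto simp: orlicz_space_iff)
    have "finite {y \<in> ?X. \<Psi> (b g x) \<le> \<Psi> (b g y)}"
      using bg nz by (intro finite_superlevel_of_summable pos) (auto simp: orlicz_space_iff)
    moreover have "(\<lambda>n. inv\<^bsub>G\<^esub> n \<otimes>\<^bsub>G\<^esub> x) ` N \<subseteq> {y \<in> ?X. \<Psi> (b g x) \<le> \<Psi> (b g y)}"
    proof (rule image_subsetI)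
      fix n assume n: "n \<in> N"
      have "b g x = b g (inv\<^bsub>G\<^esub> n \<otimes>\<^bsub>G\<^esub> x)"
        using fun_cong[OF inv[OF n], of x] x by (simp add: left_regular_def)
      then show "inv\<^bsub>G\<^esub> n \<otimes>\<^bsub>G\<^esub> x \<in> {y \<in> ?X. \<Psi> (b g x) \<le> \<Psi> (b g y)}"
        using n x by simp
    qed
    moreover have "inj_on (\<lambda>n. inv\<^bsub>G\<^esub> n \<otimes>\<^bsub>G\<^esub> x) N"
      using x by (intro inj_onI) (metis N.inv_closed N.inv_inv N.mem_carrier N.right_cancel)
    ultimately show False
      using \<open>infinite N\<close> by (metis finite_imageD finite_subset)
  qed
qed

lemma coboundary_in_cocycles:
  fixes G :: "('g, 'm) monoid_scheme"
  assumes "group G" "f \<in> orlicz_space \<Phi> (carrier G)"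
  shows "(\<lambda>g. if g \<in> carrier G then left_regular G g f - f else 0)
    \<in> cocycles G (orlicz_space \<Phi> (carrier G)) (left_regular G)"
proof -
  interpret group G by fact
  have "left_regular G (g \<otimes>\<^bsub>G\<^esub> h) f - f
      = left_regular G g f - f + left_regular G g (left_regular G h f - f)"
    if "g \<in> carrier G" "h \<in> carrier G" for g h
    using that assms(2)
    by (auto simp: fun_eq_iff left_regular_def inv_mult_group m_assoc)
  then show ?thesis
    using assms by (auto simp: cocycles_def left_regular_in_orlicz_space orlicz_space_diff)
qed

lemma cocycles_add:
  assumes "b \<in> cocycles G (orlicz_space \<Phi> (carrier G)) (left_regular G)"
    and "c \<in> cocycles G (orlicz_space \<Phi> (carrier G)) (left_regular G)"
  shows "b + c \<in> cocycles G (orlicz_space \<Phi> (carrier G)) (left_regular G)"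
  using assms by (auto simp: cocycles_def orlicz_space_add left_regular_def fun_eq_iff)

lemma cocycles_uminus:
  assumes "b \<in> cocycles G (orlicz_space \<Phi> (carrier G)) (left_regular G)"
  shows "- b \<in> cocycles G (orlicz_space \<Phi> (carrier G)) (left_regular G)"
  using assms by (auto simp: cocycles_def orlicz_space_uminus left_regular_def fun_eq_iff)

lemma trivial_H1I:
  fixes G :: "('g, 'm) monoid_scheme"
  defines "V \<equiv> orlicz_space \<Phi> (carrier G)"
  assumes "cocycles G V (left_regular G) \<subseteq> coboundaries G V (left_regular G)"
  shows "trivial_group (H1 G V (left_regular G))"
proof -
  let ?Z = "cocycle_group G V (left_regular G)"
  have eq: "coboundaries G V (left_regular G) = carrier ?Z"
    using assms(2) by (auto simp: cocycle_group_def coboundaries_def)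
  have zero: "0 \<in> cocycles G V (left_regular G)"
    by (auto simp: cocycles_def V_def left_regular_def fun_eq_iff)
  interpret Z: comm_group ?Z
  proof (rule comm_groupI)
    fix b assume b: "b \<in> carrier ?Z"
    then have "- b \<in> carrier ?Z"
      using cocycles_uminus by (simp add: cocycle_group_def V_def)
    then show "\<exists>c\<in>carrier ?Z. c \<otimes>\<^bsub>?Z\<^esub> b = \<one>\<^bsub>?Z\<^esub>"
      by (intro bexI[of _ "- b"]) (auto simp: cocycle_group_def)
  qed (use zero in \<open>auto simp: cocycle_group_def V_def cocycles_add ac_simps\<close>)
  have "carrier ?Z \<lhd> ?Z"
    by (rule Z.subgroup_imp_normal[OF Z.subgroup_self])
  then have "group (?Z Mod carrier ?Z)"
    by (rule normal.factorgroup_is_group)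
  moreover have "carrier (?Z Mod carrier ?Z) = {carrier ?Z}"
    using Z.one_closed Z.coset_join2[OF _ Z.subgroup_self] by (auto simp: carrier_FactGroup)
  ultimately show ?thesis
    by (simp add: trivial_group_def H1_def eq)
qed

end

theorem theorem2p5:
  fixes \<Phi> :: "real \<Rightarrow> real" and G :: "('g, 'm) monoid_scheme" and N H :: "'g set"
  assumes "N_function \<Phi>" and "Delta2_at_0 \<Phi>"
    and "group G" and "countable (carrier G)"
    and "subgroup H G" and "N \<subseteq> H" and "N \<lhd> G" and "infinite N"
    and "\<not> amenable (G\<lparr>carrier := H\<rparr>)"
    and "trivial_group (reduced_H1 (G\<lparr>carrier := H\<rparr>) (orlicz_space \<Phi> H) (gauge_norm \<Phi> H)
           (left_regular (G\<lparr>carrier := H\<rparr>)))"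
  shows "trivial_group (H1 G (orlicz_space \<Phi> (carrier G)) (left_regular G))"
proof -
  obtain \<Psi> K r where "doubling_young \<Psi> K" "0 < r" and agree: "\<And>x. \<bar>x\<bar> \<le> r \<Longrightarrow> \<Psi> x = \<Phi> x"
    using Delta2_imp_doubling_modification[OF assms(1,2)] by blast
  then interpret Orlicz_modification \<Phi> \<Psi> K r
    by (intro Orlicz_modification.intro Orlicz_modification_axioms.intro N_function_imp_young assms(1))
  let ?V = "orlicz_space \<Phi> (carrier G)" and ?\<pi> = "left_regular G"
  show ?thesis
  proof (rule trivial_H1I, rule subsetI)
    fix b assume b: "b \<in> cocycles G ?V ?\<pi>"
    obtain f where f: "f \<in> ?V" "\<And>h. h \<in> H \<Longrightarrow> b h = ?\<pi> h f - f"
      using restriction_is_coboundary[OF assms(3,4,5,9,10) b] by blast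
    define d where "d = (\<lambda>g. if g \<in> carrier G then ?\<pi> g f - f else 0)"
    have "d \<in> cocycles G ?V ?\<pi>"
      unfolding d_def by (rule coboundary_in_cocycles[OF assms(3) f(1)])
    then have bd: "b + - d \<in> cocycles G ?V ?\<pi>"
      by (intro cocycles_add cocycles_uminus b)
    have "(b + - d) n = 0" if "n \<in> N" for n
      using that f(2)[of n] assms(6) subgroup.subset[OF assms(5)] by (auto simp: d_def)
    then have "(b + - d) g = 0" if "g \<in> carrier G" for g
      by (rule cocycle_vanishing_on_infinite_normal_subgroup[OF assms(7,8) bd _ that])
    then have "b g = ?\<pi> g f - f" if "g \<in> carrier G" for g
      using that by (auto simp: d_def dest: meta_spec[of _ g])
    then show "b \<in> coboundaries G ?V ?\<pi>"
      using b f(1) by (auto simp: coboundaries_def)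
  qed
qed

end
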